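(* Let $f\colon \mathbb{H}^n \to \mathbb{R}$ be Lipschitz, $x\in \mathbb{H}^n$ and $E\in V$ with $\omega(E)=1$. Suppose $Ef(x)$ exists and $Ef(x)=\mathrm{Lip}_{\mathbb{H}}(f)$. Then $f$ is Pansu differentiable at $x$ with Pansu derivative $L(y)=\mathrm{Lip}_{\mathbb{H}}(f)\langle y, E(0) \rangle = \mathrm{Lip}_{\mathbb{H}}(f)\langle p(y), p(E) \rangle$ for $y\in\mathbb{H}^n$.
   Context: Fix an integer $n\geq 1$. The Heisenberg group $\mathbb{H}^n$ is $\mathbb{R}^{2n+1}$, with points written $(a,b,c)$, $a,b\in\mathbb{R}^n$, $c\in\mathbb{R}$, equipped with the group law $(a,b,c)(a',b',c')=(a+a',b+b',c+c'-2(\langle a,b'\rangle-\langle b,a'\rangle))$. Dilations are $\delta_r(a,b,c)=(ra,rb,r^2c)$ for $r>0$; $p\colon\mathbb{H}^n\to\mathbb{R}^{2n}$ is the projection onto the first $2n$ coordinates. For $1\le i\le n$ define vector fields $X_i(a,b,c)=e_i+2b_ie_{2n+1}$, $Y_i(a,b,c)=e_{n+i}-2a_ie_{2n+1}$, where $e_1,\dots,e_{2n+1}$ is the standard basis. $V=\mathrm{Span}\{X_i,Y_i:1\le i\le n\}$ and $\omega$ is the inner product norm on $V$ making $\{X_i,Y_i\}$ orthonormal. For $E\in V$, $p(E):=p(E(x))\in\mathbb{R}^{2n}$ does not depend on $x$. $\langle\cdot,\cdot\rangle$ and $|\cdot|$ are the Euclidean inner product and norm. An absolutely continuous curve $\gamma\colon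 I\to\mathbb{H}^n$ ($I\subset\mathbb{R}$ an interval) is horizontal if there is $h\colon I\to\mathbb{R}^{2n}$ with $\gamma'(t)=\sum_{i=1}^n(h_i(t)X_i(\gamma(t))+h_{n+i}(t)Y_i(\gamma(t)))$ for a.e. $t\in I$; its horizontal length is $L_{\mathbb{H}}(\gamma)=\int_I|h|$. The Carnot-Carathéodory distance is $d(x,y)=\inf\{L_{\mathbb{H}}(\gamma):\gamma \text{ a horizontal curve joining } x \text{ to } y\}$. "Lipschitz" is with respect to $d$ when the domain or target is $\mathbb{H}^n$, and $\mathrm{Lip}_{\mathbb{H}}$ is the corresponding Lipschitz constant. For $f\colon\mathbb{H}^n\to\mathbb{R}$ Lipschitz and $E\in V$, $Ef(x):=(f\circ\gamma)'(t)$ whenever it exists, where $\gamma$ is any Lipschitz horizontal curve with $\gamma(t)=x$ and $\gamma'(t)=E(x)$ (independent of the choice of $\gamma$; e.g. $Ef(x)=\lim_{t\to0}(f(x+tE(x))-f(x))/t$). A function $L\colon\mathbb{H}^n\to\mathbb{R}$ is $\mathbb{H}$-linear if $L(xy)=L(x)+L(y)$ and $L(\delta_r(x))=rL(x)$ for all $x,y\in\mathbb{H}^n$, $r>0$. A function $f\colon\mathbb{H}^n\to\mathbb{R}$ is Pansu differentiable at $x$ with Pansu derivative $L$ if $L$ is $\mathbb{H}$-linear and $\lim_{y\to x}|f(y)-f(x)-L(x^{-1}y)|/d(x,y)=0$. *)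

theory Defs
  imports "HOL-Analysis.Analysis"
begin

section \<open>The Heisenberg group\<close>

text \<open>The points of the Heisenberg group are those of the Euclidean space \<open>\<real>\<^sup>2\<^sup>n\<^sup>+\<^sup>1\<close>, with
  \<open>n = CARD('n) \<ge> 1\<close>. The operations \<open>+\<close>, \<open>\<bullet>\<close>, \<open>norm\<close> and the filter \<open>at x\<close> on this type
  are the Euclidean ones; the group operation is \<open>heis_mult\<close>, and the Carnot-Caratheodory
  distance \<open>cc_dist\<close> is kept apart from the Euclidean \<open>dist\<close>.\<close>

type_synonym 'n heis = "(real ^ 'n) \<times> (real ^ 'n) \<times> real"

fun heis_mult :: "'n::finite heis \<Rightarrow> 'n heis \<Rightarrow> 'n heis" where
  "heis_mult (a, b, c) (a', b', c') = (a + a', b + b', c + c' - 2 * (a \<bullet> b' - b \<bullet> a'))"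

fun heis_inv :: "'n::finite heis \<Rightarrow> 'n heis" where
  "heis_inv (a, b, c) = (- a, - b, - c)"

fun heis_dil :: "real \<Rightarrow> 'n::finite heis \<Rightarrow> 'n heis" where
  "heis_dil r (a, b, c) = (r *\<^sub>R a, r *\<^sub>R b, r\<^sup>2 * c)"

fun hproj :: "'n::finite heis \<Rightarrow> (real ^ 'n) \<times> (real ^ 'n)" where
  "hproj (a, b, c) = (a, b)"

lemma heis_mult_assoc: "heis_mult (heis_mult x y) z = heis_mult x (heis_mult y z)"
  by (cases x; cases y; cases z) (simp add: inner_add_left inner_add_right algebra_simps)

lemma heis_mult_zero: "heis_mult 0 x = x" "heis_mult x 0 = x"
  by (cases x; simp add: zero_prod_def)+

lemma heis_mult_inv: "heis_mult (heis_inv x) x = 0" "heis_mult x (heis_inv x) = 0"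
  by (cases x; simp add: zero_prod_def inner_commute)+


section \<open>Horizontal vector fields\<close>

fun XF :: "'n::finite \<Rightarrow> 'n heis \<Rightarrow> 'n heis" where
  "XF i (a, b, c) = (axis i 1, 0, 2 * b $ i)"

fun YF :: "'n::finite \<Rightarrow> 'n heis \<Rightarrow> 'n heis" where
  "YF i (a, b, c) = (0, axis i 1, - 2 * a $ i)"

text \<open>The linear combination of the fields \<open>X\<^sub>i, Y\<^sub>i\<close> with coefficient vector \<open>h \<in> \<real>\<^sup>2\<^sup>n\<close>.\<close>

definition hfield :: "(real ^ 'n::finite) \<times> (real ^ 'n) \<Rightarrow> 'n heis \<Rightarrow> 'n heis" where
  "hfield h q = (\<Sum>i\<in>UNIV. (fst h $ i) *\<^sub>R XF i q + (snd h $ i) *\<^sub>R YF i q)"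

definition HV :: "('n::finite heis \<Rightarrow> 'n heis) set" where
  "HV = range hfield"

text \<open>The norm on \<open>HV\<close> for which the basis \<open>X\<^sub>i, Y\<^sub>i\<close> is orthonormal is the Euclidean norm
  of the coordinates in that basis; these are unique by \<open>hfield_inject\<close> below.\<close>

definition omega :: "('n::finite heis \<Rightarrow> 'n heis) \<Rightarrow> real" where
  "omega E = norm (THE h. E = hfield h)"

definition hproj_field :: "('n::finite heis \<Rightarrow> 'n heis) \<Rightarrow> (real ^ 'n) \<times> (real ^ 'n)" where
  "hproj_field E = hproj (E 0)"

lemma hfield_eq:
  "hfield h (a, b, c) = (fst h, snd h, 2 * (fst h \<bullet> b - snd h \<bullet> a))"
proof -
  have 1: "(\<Sum>i\<in>UNIV. (v $ i) *\<^sub>R axis i (1::real)) = v" for v :: "real ^ 'n"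
    by (simp add: vec_eq_iff axis_def if_distrib[of "(*) _"] sum.delta cong: if_cong)
  show ?thesis
    by (simp add: hfield_def prod_eq_iff fst_sum snd_sum 1 inner_vec_def sum_subtractf
        sum_distrib_left algebra_simps)
qed

lemma hproj_hfield: "hproj (hfield h q) = h"
  by (cases q) (simp add: hfield_eq)

lemma hfield_inject: "hfield h = hfield k \<longleftrightarrow> h = k"
  by (metis hproj_hfield)

lemma omega_hfield: "omega (hfield h) = norm h"
  by (simp add: omega_def hfield_inject)

lemma hproj_field_eq: "E \<in> HV \<Longrightarrow> hproj (E q) = hproj_field E"
  by (auto simp: HV_def hproj_field_def hproj_hfield)


section \<open>Horizontal curves and the Carnot-Caratheodory distance\<close>

text \<open>The finite families of non-overlapping compact subintervals of \<open>I\<close> are the divisions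
  of subsets of \<open>I\<close>.\<close>

definition abs_cont_on :: "real set \<Rightarrow> (real \<Rightarrow> 'b::real_normed_vector) \<Rightarrow> bool" where
  "abs_cont_on I \<gamma> \<longleftrightarrow>
    (\<forall>\<epsilon>>0. \<exists>\<delta>>0. \<forall>D S. D division_of S \<and> S \<subseteq> I \<and> (\<Sum>k\<in>D. Sup k - Inf k) < \<delta> \<longrightarrow>
      (\<Sum>k\<in>D. norm (\<gamma> (Sup k) - \<gamma> (Inf k))) < \<epsilon>)"

definition horizontal_coeffs ::
  "real set \<Rightarrow> (real \<Rightarrow> 'n::finite heis) \<Rightarrow> (real \<Rightarrow> (real ^ 'n) \<times> (real ^ 'n)) \<Rightarrow> bool" where
  "horizontal_coeffs I \<gamma> h \<longleftrightarrow>
    (AE t in lebesgue. t \<in> I \<longrightarrow> (\<gamma> has_vector_derivative hfield (h t) (\<gamma> t)) (at t within I))"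

definition horizontal_curve :: "real set \<Rightarrow> (real \<Rightarrow> 'n::finite heis) \<Rightarrow> bool" where
  "horizontal_curve I \<gamma> \<longleftrightarrow>
    is_interval I \<and> abs_cont_on I \<gamma> \<and> (\<exists>h. horizontal_coeffs I \<gamma> h)"

text \<open>The coefficients \<open>h\<close> are determined by \<open>\<gamma>\<close> almost everywhere, so the length does not
  depend on their choice (\<open>horizontal_length_eq\<close>). Only lengths of horizontal curves on compact
  intervals are needed; there \<open>norm \<circ> h\<close> is Lebesgue integrable, since \<open>\<gamma>\<close> is absolutely
  continuous, and the gauge integral \<open>integral\<close> is the Lebesgue integral.\<close>

definition horizontal_length :: "real set \<Rightarrow> (real \<Rightarrow> 'n::finite heis) \<Rightarrow> real" where
  "horizontal_length I \<gamma> = integral I (\<lambda>t. norm ((SOME h. horizontal_coeffs I \<gamma> h) t))"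

lemma horizontal_length_eq:
  assumes h: "horizontal_coeffs {a..b} \<gamma> h"
  shows "horizontal_length {a..b} \<gamma> = integral {a..b} (\<lambda>t. norm (h t))"
proof (cases "a < b")
  case True
  define k where "k = (SOME h. horizontal_coeffs {a..b} \<gamma> h)"
  have k: "horizontal_coeffs {a..b} \<gamma> k"
    unfolding k_def using h by (rule someI[of "horizontal_coeffs {a..b} \<gamma>"])
  have "AE t in lebesgue. t \<in> {a..b} \<longrightarrow> k t = h t"
    using h k unfolding horizontal_coeffs_def
  proof eventually_elim
    case (elim t)
    show ?case
    proof
      assume t: "t \<in> {a..b}"
      then have "hfield (k t) (\<gamma> t) = hfield (h t) (\<gamma> t)"
        using elim True
        by (intro vector_derivative_unique_within_closed_interval[of a b t \<gamma>])
          (simp_all del: atLeastAtMost_iff add: cbox_interval)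
      then have "hproj (hfield (k t) (\<gamma> t)) = hproj (hfield (h t) (\<gamma> t))"
        by (rule arg_cong)
      then show "k t = h t"
        by (simp only: hproj_hfield)
    qed
  qed
  then obtain N where N: "N \<in> null_sets lebesgue"
      "{t \<in> space lebesgue. \<not> (t \<in> {a..b} \<longrightarrow> k t = h t)} \<subseteq> N"
    unfolding eventually_ae_filter by (elim bexE)
  have "negligible N" "\<And>t. t \<in> {a..b} - N \<Longrightarrow> k t = h t"
    using N by (simp add: negligible_iff_null_sets, force)
  then have "integral {a..b} (\<lambda>t. norm (k t)) = integral {a..b} (\<lambda>t. norm (h t))"
    by (intro integral_spike[of N]) simp_all
  then show ?thesis
    by (simp add: horizontal_length_def k_def)
next
  case False
  then have "b \<le> a"
    by simp
  then have "integral {a..b} g = 0" for g :: "real \<Rightarrow> real"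
    by (cases "a = b") simp_all
  then show ?thesis
    by (simp only: horizontal_length_def)
qed

text \<open>Any two points are joined by a horizontal curve and lengths are nonnegative, so the real
  \<open>Inf\<close> is the infimum of a nonempty set that is bounded below.\<close>

definition cc_dist :: "'n::finite heis \<Rightarrow> 'n heis \<Rightarrow> real" where
  "cc_dist x y =
    Inf {horizontal_length {a..b} \<gamma> |a b \<gamma>.
      a \<le> b \<and> horizontal_curve {a..b} \<gamma> \<and> \<gamma> a = x \<and> \<gamma> b = y}"


section \<open>Lipschitz maps and derivatives\<close>

definition heis_lipschitz :: "('n::finite heis \<Rightarrow> real) \<Rightarrow> bool" where
  "heis_lipschitz f \<longleftrightarrow> (\<exists>C\<ge>0. \<forall>x y. \<bar>f x - f y\<bar> \<le> C * cc_dist x y)"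

definition heis_Lip :: "('n::finite heis \<Rightarrow> real) \<Rightarrow> real" where
  "heis_Lip f = Inf {C. 0 \<le> C \<and> (\<forall>x y. \<bar>f x - f y\<bar> \<le> C * cc_dist x y)}"

definition lipschitz_curve :: "real set \<Rightarrow> (real \<Rightarrow> 'n::finite heis) \<Rightarrow> bool" where
  "lipschitz_curve I \<gamma> \<longleftrightarrow> (\<exists>C\<ge>0. \<forall>s\<in>I. \<forall>t\<in>I. cc_dist (\<gamma> s) (\<gamma> t) \<le> C * \<bar>s - t\<bar>)"

text \<open>\<open>has_field_deriv f E x D\<close>: the derivative \<open>Ef(x)\<close> exists and equals \<open>D\<close>. For Lipschitz
  \<open>f\<close> neither the existence nor the value of \<open>D\<close> depends on the curve \<open>\<gamma>\<close>. The parameter \<open>t\<close>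
  is interior to \<open>I\<close>, so that both derivatives are two-sided.\<close>

definition has_field_deriv ::
  "('n::finite heis \<Rightarrow> real) \<Rightarrow> ('n heis \<Rightarrow> 'n heis) \<Rightarrow> 'n heis \<Rightarrow> real \<Rightarrow> bool" where
  "has_field_deriv f E x D \<longleftrightarrow>
    (\<exists>I \<gamma> t. horizontal_curve I \<gamma> \<and> lipschitz_curve I \<gamma> \<and> t \<in> interior I \<and>
      \<gamma> t = x \<and> (\<gamma> has_vector_derivative E x) (at t) \<and>
      ((\<lambda>s. f (\<gamma> s)) has_real_derivative D) (at t))"

definition heis_linear :: "('n::finite heis \<Rightarrow> real) \<Rightarrow> bool" where
  "heis_linear L \<longleftrightarrow>
    (\<forall>x y. L (heis_mult x y) = L x + L y) \<and> (\<forall>r>0. \<forall>x. L (heis_dil r x) = r * L x)"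

text \<open>The limit \<open>y \<rightarrow> x\<close> is in the Euclidean topology, which is also the topology of
  \<open>cc_dist\<close>.\<close>

definition has_pansu_derivative ::
  "('n::finite heis \<Rightarrow> real) \<Rightarrow> ('n heis \<Rightarrow> real) \<Rightarrow> 'n heis \<Rightarrow> bool" where
  "has_pansu_derivative f L x \<longleftrightarrow>
    heis_linear L \<and>
    ((\<lambda>y. \<bar>f y - f x - L (heis_mult (heis_inv x) y)\<bar> / cc_dist x y) \<longlongrightarrow> 0) (at x)"

end

theory Submission
  imports Defs
begin

text \<open>
  Write \<open>L\<close> for the Lipschitz constant of \<open>f\<close>, \<open>e \<in> \<real>\<^sup>2\<^sup>n\<close> for the unit coordinate vector of \<open>E\<close>, and
  \<open>p\<close> for the horizontal part of \<open>w = x\<^sup>-\<^sup>1 y\<close>. Since \<open>Ef(x) = L\<close>, moving from \<open>x\<close> by a parameter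
  \<open>t\<close> along a curve \<open>\<gamma>\<close> tangent to \<open>E\<close> changes \<open>f\<close> by \<open>L t + o(t)\<close>, as much as the Lipschitz
  condition permits. This pins \<open>f(y)\<close> from both sides:
  \<open>f(y) \<ge> f(\<gamma>(t\<^sub>0 + t)) - L d(\<gamma>(t\<^sub>0 + t), y)\<close> and \<open>f(y) \<le> f(\<gamma>(t\<^sub>0 - t)) + L d(\<gamma>(t\<^sub>0 - t), y)\<close>. If
  \<open>d(\<gamma>(t\<^sub>0 \<plusminus> t), y) \<le> t \<minusplus> \<langle>p, e\<rangle> + small\<close>, the terms \<open>L t\<close> cancel and both bounds become
  \<open>f(x) + L \<langle>p, e\<rangle>\<close> up to an error. The parameter is taken to be \<open>t = K r\<close>, where \<open>r\<close> is the size of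
  \<open>w\<close> in the homogeneous norm and \<open>K\<close> is a large constant; the error is then \<open>O(r / K)\<close> as \<open>r \<rightarrow> 0\<close>
  (\<open>maximal_directional_derivative_estimate\<close>), which is enough because \<open>r\<close> is at most a multiple
  of \<open>d(x, y)\<close>.

  The distance estimate (\<open>cc_dist_from_far_point\<close>) says that the distance from a far point is
  differentiable in horizontal directions. It follows from an explicit horizontal curve
  (\<open>cc_lengths_arc\<close>): a parabolic arc over the segment from \<open>0\<close> to \<open>v\<close> reaches height \<open>c\<close> with
  length \<open>|v| (1 + O((c / |v|\<^sup>2)\<^sup>2))\<close>. The quadratic dependence on \<open>c / |v|\<^sup>2\<close> is what makes the
  argument work: here \<open>|v|\<close> is comparable to \<open>K r\<close> and \<open>c\<close> to \<open>K r\<^sup>2\<close>, so that the excess length is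
  \<open>O(r / K)\<close>, whereas a linear bound would only give \<open>O(r)\<close>.

  The curve \<open>\<gamma>\<close> is not a straight line, and differentiability at \<open>t\<^sub>0\<close> controls its height over \<open>x\<close>
  only to order \<open>o(t)\<close>, while \<open>o(t\<^sup>2)\<close> is needed. The better order comes from the Lipschitz
  condition (\<open>lipschitz_curve_tangent\<close>).

  All this uses the bounds \<open>|p| \<le> d(0, w)\<close> and \<open>|c| \<le> 2 d(0, w)\<^sup>2\<close> for \<open>w = (p, c)\<close>, which hold because
  a horizontal curve is recovered from its coefficients by integration. That is the fundamental
  theorem of calculus for absolutely continuous functions (\<open>abs_cont_on_has_integral\<close>).
\<close>


section \<open>Absolutely continuous functions on an interval\<close>

lemma division_of_realE:
  fixes D :: "real set set"
  assumes "D division_of S" "K \<in> D"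
  obtains u v where "K = {u..v}" "u \<le> v" "Inf K = u" "Sup K = v" "K \<subseteq> S"
proof -
  obtain u v where "K = cbox u v" "K \<noteq> {}" "K \<subseteq> S"
    using division_ofD(2,3,4)[OF assms(1)] assms(2) by metis
  then show thesis
    using that[of u v] by auto
qed

text \<open>In a Riemann sum over a fine tagged division, an interval whose tag is a point of
  differentiability contributes the increment of \<open>g\<close> up to a small multiple of its length. The
  intervals with exceptional tags lie in an open set of small measure, so absolute continuity makes
  the total increment over them small; the integrand is first set to \<open>0\<close> at those tags.\<close>

lemma abs_cont_on_has_integral:
  fixes g :: "real \<Rightarrow> 'b::real_normed_vector"
  assumes ac: "abs_cont_on {a..b} g" and "a \<le> b"
    and deriv: "AE t in lebesgue. t \<in> {a..b} \<longrightarrow> (g has_vector_derivative g' t) (at t within {a..b})"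
  shows "(g' has_integral g b - g a) {a..b}"
proof -
  obtain N where "negligible N"
    and N: "\<And>t. t \<in> {a..b} \<Longrightarrow> t \<notin> N \<Longrightarrow> (g has_vector_derivative g' t) (at t within {a..b})"
  proof -
    obtain N where N: "N \<in> null_sets lebesgue"
      "{t \<in> space lebesgue. \<not> (t \<in> {a..b} \<longrightarrow> (g has_vector_derivative g' t) (at t within {a..b}))} \<subseteq> N"
      using deriv unfolding eventually_ae_filter by (elim bexE)
    show thesis
      using N by (intro that[of N]) (auto simp add: negligible_iff_null_sets)
  qed
  define k where "k t = (if t \<in> N then 0 else g' t)" for t
  have "(k has_integral g b - g a) {a..b}"
    unfolding has_integral_real
  proof (intro allI impI)
    fix e :: real
    assume "e > 0"
    \<comment> \<open>The \<open>+ 1\<close> keeps the denominator positive when \<open>a = b\<close>.\<close>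
    define e1 where "e1 = e / (2 * (b - a + 1))"
    have "e1 > 0"
      using \<open>e > 0\<close> \<open>a \<le> b\<close> by (simp add: e1_def)
    have e1: "e1 * (b - a) < e / 2"
      using \<open>e > 0\<close> \<open>a \<le> b\<close> by (simp add: e1_def field_simps)
    obtain \<delta> where "\<delta> > 0" and \<delta>: "\<And>D S. D division_of S \<Longrightarrow> S \<subseteq> {a..b} \<Longrightarrow>
        (\<Sum>k\<in>D. Sup k - Inf k) < \<delta> \<Longrightarrow> (\<Sum>k\<in>D. norm (g (Sup k) - g (Inf k))) < e / 2"
      using ac \<open>e > 0\<close> unfolding abs_cont_on_def by (metis half_gt_zero)
    obtain U where "open U" "N \<subseteq> U" and U: "U \<in> lmeasurable" "measure lebesgue U < \<delta>"
    proof -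
      have "N \<in> sets lebesgue" "emeasure lebesgue N = 0"
        using \<open>negligible N\<close> by (auto simp: negligible_iff_null_sets)
      then obtain T where T: "open T" "N \<subseteq> T" "T - N \<in> lmeasurable" "emeasure lebesgue (T - N) < ennreal \<delta>"
        using sets_lebesgue_outer_open \<open>\<delta> > 0\<close> by metis
      have eq: "T = N \<union> (T - N)" using T by auto
      have 1: "T \<in> lmeasurable"
        by (subst eq) (intro fmeasurable.Un negligible_imp_measurable T(3) \<open>negligible N\<close>)
      have "measure lebesgue T \<le> measure lebesgue N + measure lebesgue (T - N)"
        by (subst eq) (intro measure_Un_le fmeasurableD negligible_imp_measurable T(3) \<open>negligible N\<close>)
      also have "\<dots> < \<delta>"
        using T(3,4) \<open>negligible N\<close> \<open>\<delta> > 0\<close>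
        by (simp add: negligible_imp_measure0 emeasure_eq_measure2 ennreal_less_iff)
      finally show thesis
        using that[of T] T 1 by auto
    qed
    have "\<exists>r>0. (t \<in> N \<longrightarrow> ball t r \<subseteq> U) \<and> (t \<in> {a..b} - N \<longrightarrow>
        (\<forall>s\<in>{a..b}. norm (s - t) < r \<longrightarrow> norm (g s - g t - (s - t) *\<^sub>R g' t) \<le> e1 * norm (s - t)))" for t
    proof (cases "t \<in> N")
      case True
      then show ?thesis
        using \<open>open U\<close> \<open>N \<subseteq> U\<close> open_contains_ball by blast
    next
      case False
      show ?thesis
      proof (cases "t \<in> {a..b}")
        case True
        then show ?thesis
          using N[OF True False] False \<open>e1 > 0\<close>
          unfolding has_vector_derivative_def has_derivative_within_alt by auto
      next
        case False2: False
        then show ?thesis using False by (auto intro: exI[of _ 1])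
      qed
    qed
    then obtain r where r: "\<And>t. r t > 0" "\<And>t. t \<in> N \<Longrightarrow> ball t (r t) \<subseteq> U"
      "\<And>s t. t \<in> {a..b} - N \<Longrightarrow> s \<in> {a..b} \<Longrightarrow> norm (s - t) < r t \<Longrightarrow>
          norm (g s - g t - (s - t) *\<^sub>R g' t) \<le> e1 * norm (s - t)"
      by metis
    show "\<exists>\<gamma>. gauge \<gamma> \<and> (\<forall>p. p tagged_division_of {a..b} \<and> \<gamma> fine p \<longrightarrow>
        norm ((\<Sum>(x, K)\<in>p. measure lborel K *\<^sub>R k x) - (g b - g a)) < e)"
    proof (intro exI conjI allI impI)
      show "gauge (\<lambda>t. ball t (r t))"
        using r(1) by (simp add: gauge_def)
      fix p
      assume "p tagged_division_of {a..b} \<and> (\<lambda>t. ball t (r t)) fine p"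
      then have p: "p tagged_division_of {a..b}" and fine: "(\<lambda>t. ball t (r t)) fine p"
        by auto
      note pD = tagged_division_ofD[OF p]
      have K: "\<exists>u v. K = {u..v} \<and> u \<le> x \<and> x \<le> v \<and> Inf K = u \<and> Sup K = v \<and> a \<le> u \<and> v \<le> b
          \<and> K \<subseteq> ball x (r x) \<and> measure lborel K = v - u"
        if xK: "(x, K) \<in> p" for x K
      proof -
        obtain u v where uv: "K = {u..v}" using pD(4)[OF xK] by auto
        then have "u \<le> x" "x \<le> v" using pD(2)[OF xK] by auto
        moreover have "K \<subseteq> {a..b}" using pD(3)[OF xK] .
        moreover have "K \<subseteq> ball x (r x)" using fine xK by (auto simp: fine_def)
        ultimately show ?thesis using uv by (intro exI[of _ u] exI[of _ v]) auto
      qed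
      let ?d = "\<lambda>K::real set. g (Sup K) - g (Inf K)"
      define q where "q = {(x, K) \<in> p. x \<in> N}"
      have "q \<subseteq> p" "finite p" by (auto simp: q_def pD(1))
      then have "finite q" by (rule finite_subset)
      have qpart: "q tagged_partial_division_of {a..b}"
        using p \<open>q \<subseteq> p\<close> tagged_partial_division_subset tagged_division_of_def by blast
      have q: "q tagged_division_of \<Union>(snd ` q)"
        using qpart by (rule tagged_partial_division_of_Union_self)
      have qdiv: "snd ` q division_of \<Union>(snd ` q)"
        using qpart by (rule partial_division_of_tagged_division)
      have Uq: "\<Union>(snd ` q) \<subseteq> {a..b}"
        using pD(3) \<open>q \<subseteq> p\<close> by fastforce
      have "(\<Sum>k\<in>snd ` q. Sup k - Inf k) = (\<Sum>k\<in>snd ` q. measure lebesgue k)"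
      proof (rule sum.cong)
        fix S assume "S \<in> snd ` q"
        then obtain x where "(x, S) \<in> p" by (auto simp: q_def)
        from K[OF this] obtain u v where "S = {u..v}" "Inf S = u" "Sup S = v" "measure lborel S = v - u"
          by blast
        then show "Sup S - Inf S = measure lebesgue S"
          by (simp add: measure_completion)
      qed simp
      also have "\<dots> = measure lebesgue (\<Union>(snd ` q))"
      proof (rule measure_negligible_finite_Union[symmetric])
        show "finite (snd ` q)" using \<open>finite q\<close> by simp
        show "S \<in> lmeasurable" if "S \<in> snd ` q" for S
          using division_ofD(4)[OF qdiv that] by auto
        show "pairwise (\<lambda>S T. negligible (S \<inter> T)) (snd ` q)"
          unfolding pairwise_def
        proof (intro ballI impI)
          fix S T assume ST: "S \<in> snd ` q" "T \<in> snd ` q" "S \<noteq> T"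
          obtain u v where "S = cbox u v" using division_ofD(4)[OF qdiv ST(1)] by auto
          moreover obtain u' v' where "T = cbox u' v'" using division_ofD(4)[OF qdiv ST(2)] by auto
          moreover have "interior (S \<inter> T) = {}" using division_ofD(5)[OF qdiv ST] by auto
          ultimately show "negligible (S \<inter> T)"
            by (metis (no_types) Int_interval interior_cbox negligible_interval(1))
        qed
      qed
      also have "\<dots> \<le> measure lebesgue U"
      proof (rule measure_mono_fmeasurable)
        show "\<Union> (snd ` q) \<subseteq> U"
        proof (rule Union_least)
          fix S assume "S \<in> snd ` q"
          then obtain x where "(x, S) \<in> p" "x \<in> N" by (auto simp: q_def)
          then show "S \<subseteq> U" using K[of x S] r(2)[of x] by auto
        qed
        show "\<Union> (snd ` q) \<in> sets lebesgue"
        proof (rule sets.finite_Union)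
          show "snd ` q \<subseteq> sets lebesgue"
          proof
            fix S assume "S \<in> snd ` q"
            then obtain u v where "S = cbox u v" using division_ofD(4)[OF qdiv] by blast
            then show "S \<in> sets lebesgue" by simp
          qed
        qed (simp add: \<open>finite q\<close>)
      qed (fact U)
      finally have "(\<Sum>k\<in>snd ` q. Sup k - Inf k) < \<delta>" using U by simp
      then have "(\<Sum>k\<in>snd ` q. norm (?d k)) < e / 2"
        by (rule \<delta>[OF qdiv Uq])
      moreover have "(\<Sum>(x,K)\<in>q. norm (?d K)) = (\<Sum>k\<in>snd ` q. norm (?d k))"
      proof -
        \<comment> \<open>Distinct tags can share an interval only if it is degenerate. The convention for the empty
          set is needed since degenerate boxes include \<open>{}\<close>, where \<open>Sup\<close> and \<open>Inf\<close> are arbitrary.\<close>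
        have ne: "K \<noteq> {}" if "(x, K) \<in> q" for x K
          using tagged_partial_division_ofD(2)[OF qpart that] by auto
        have "(\<Sum>(x,K)\<in>q. norm (?d K)) = (\<Sum>(x,K)\<in>q. if K = {} then 0 else norm (?d K))"
          using ne by (intro sum.cong) auto
        also have "\<dots> = (\<Sum>K\<in>snd ` q. if K = {} then 0 else norm (?d K))"
        proof (rule sum.over_tagged_division_lemma[OF q])
          fix u v :: real assume "box u v = {}"
          then show "(if cbox u v = {} then 0 else norm (?d (cbox u v))) = 0"
            by (cases "u = v") auto
        qed
        also have "\<dots> = (\<Sum>K\<in>snd ` q. norm (?d K))"
          using ne by (intro sum.cong) auto
        finally show ?thesis .
      qed
      ultimately have bad: "(\<Sum>(x,K)\<in>q. norm (?d K)) < e / 2" by simp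
      have good: "norm (measure lborel K *\<^sub>R k x - ?d K) \<le> e1 * (Sup K - Inf K)"
        if "(x, K) \<in> p - q" for x K
      proof -
        have xK: "(x, K) \<in> p" and "x \<notin> N" using that by (auto simp: q_def)
        then obtain u v where uv: "K = {u..v}" "u \<le> x" "x \<le> v" "Inf K = u" "Sup K = v" "a \<le> u" "v \<le> b"
          "K \<subseteq> ball x (r x)" "measure lborel K = v - u"
          using K[OF xK] by blast
        \<comment> \<open>The tag splits the interval in two, and both halves are compared with the derivative there.\<close>
        have "u \<in> ball x (r x)" "v \<in> ball x (r x)"
          using uv(1,2,3) by (intro subsetD[OF uv(8)]; simp)+
        then have "norm (g u - g x - (u - x) *\<^sub>R g' x) \<le> e1 * norm (u - x)"
            "norm (g v - g x - (v - x) *\<^sub>R g' x) \<le> e1 * norm (v - x)"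
          using r(3)[of x u] r(3)[of x v] uv \<open>x \<notin> N\<close> by (auto simp: dist_real_def)
        then have "norm ((g u - g x - (u - x) *\<^sub>R g' x) - (g v - g x - (v - x) *\<^sub>R g' x))
            \<le> e1 * norm (u - x) + e1 * norm (v - x)"
          by (rule order_trans[OF norm_triangle_ineq4 add_mono])
        also have "\<dots> = e1 * (Sup K - Inf K)"
          using uv by (simp add: algebra_simps)
        also have "(g u - g x - (u - x) *\<^sub>R g' x) - (g v - g x - (v - x) *\<^sub>R g' x)
            = measure lborel K *\<^sub>R k x - ?d K"
          using \<open>x \<notin> N\<close> uv by (simp add: k_def algebra_simps)
        finally show ?thesis .
      qed
      have "(\<Sum>(x, K)\<in>p. measure lborel K *\<^sub>R k x) - (g b - g a) = (\<Sum>(x,K)\<in>p. measure lborel K *\<^sub>R k x - ?d K)"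
        using additive_tagged_division_1[OF \<open>a \<le> b\<close> p, of g]
        by (simp add: sum_subtractf case_prod_unfold)
      also have "norm \<dots> \<le> (\<Sum>(x,K)\<in>p. norm (measure lborel K *\<^sub>R k x - ?d K))"
        unfolding case_prod_unfold by (rule norm_sum)
      also have "\<dots> = (\<Sum>(x,K)\<in>p - q. norm (measure lborel K *\<^sub>R k x - ?d K))
          + (\<Sum>(x,K)\<in>q. norm (measure lborel K *\<^sub>R k x - ?d K))"
        by (rule sum.subset_diff[OF \<open>q \<subseteq> p\<close> \<open>finite p\<close>])
      also have "(\<Sum>(x,K)\<in>q. norm (measure lborel K *\<^sub>R k x - ?d K)) = (\<Sum>(x,K)\<in>q. norm (?d K))"
        by (rule sum.cong) (auto simp: q_def k_def norm_minus_commute)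
      also have "(\<Sum>(x,K)\<in>p - q. norm (measure lborel K *\<^sub>R k x - ?d K)) \<le> (\<Sum>(x,K)\<in>p - q. e1 * (Sup K - Inf K))"
        using good by (intro sum_mono) auto
      also have "\<dots> \<le> (\<Sum>(x,K)\<in>p. e1 * (Sup K - Inf K))"
      proof (rule sum_mono2)
        fix z assume z: "z \<in> p - (p - q)"
        obtain x S where xS: "z = (x, S)" by (cases z)
        then have "Inf S \<le> Sup S" using K[of x S] z by auto
        then show "0 \<le> (case z of (x, K) \<Rightarrow> e1 * (Sup K - Inf K))"
          using \<open>e1 > 0\<close> by (simp add: xS)
      qed (use \<open>finite p\<close> in auto)
      also have "\<dots> = e1 * (b - a)"
        using additive_tagged_division_1[OF \<open>a \<le> b\<close> p, of "\<lambda>x. x"]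
        by (simp add: case_prod_unfold flip: sum_distrib_left)
      finally show "norm ((\<Sum>(x, K)\<in>p. measure lborel K *\<^sub>R k x) - (g b - g a)) < e"
        using e1 bad by linarith
    qed
  qed
  then show ?thesis
    by (rule has_integral_spike[OF \<open>negligible N\<close>, rotated]) (simp add: k_def)
qed

lemma abs_cont_on_subset:
  "abs_cont_on I g \<Longrightarrow> J \<subseteq> I \<Longrightarrow> abs_cont_on J g"
  unfolding abs_cont_on_def by (meson order_trans)

lemma abs_cont_on_bounded_linear:
  fixes l :: "'b::real_normed_vector \<Rightarrow> 'c::real_normed_vector"
  assumes l: "bounded_linear l" and ac: "abs_cont_on I g"
  shows "abs_cont_on I (\<lambda>t. c + l (g t))"
  unfolding abs_cont_on_def
proof (intro allI impI)
  fix e :: real assume "e > 0"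
  interpret l: bounded_linear l by fact
  obtain B where B: "B > 0" "\<And>x. norm (l x) \<le> norm x * B"
    using l.pos_bounded by blast
  obtain \<delta> where "\<delta> > 0" and \<delta>: "\<And>D S. D division_of S \<Longrightarrow> S \<subseteq> I \<Longrightarrow>
        (\<Sum>k\<in>D. Sup k - Inf k) < \<delta> \<Longrightarrow> (\<Sum>k\<in>D. norm (g (Sup k) - g (Inf k))) < e / B"
    using ac \<open>e > 0\<close> B(1) unfolding abs_cont_on_def by (metis divide_pos_pos)
  show "\<exists>\<delta>>0. \<forall>D S. D division_of S \<and> S \<subseteq> I \<and> (\<Sum>k\<in>D. Sup k - Inf k) < \<delta> \<longrightarrow>
      (\<Sum>k\<in>D. norm (c + l (g (Sup k)) - (c + l (g (Inf k))))) < e"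
  proof (intro exI[of _ \<delta>] conjI allI impI, fact)
    fix D S assume "D division_of S \<and> S \<subseteq> I \<and> (\<Sum>k\<in>D. Sup k - Inf k) < \<delta>"
    then have "(\<Sum>k\<in>D. norm (g (Sup k) - g (Inf k))) < e / B"
      using \<delta> by blast
    moreover have "(\<Sum>k\<in>D. norm (c + l (g (Sup k)) - (c + l (g (Inf k)))))
        \<le> (\<Sum>k\<in>D. norm (g (Sup k) - g (Inf k)) * B)"
      by (intro sum_mono) (simp add: B(2) flip: l.diff)
    ultimately show "(\<Sum>k\<in>D. norm (c + l (g (Sup k)) - (c + l (g (Inf k))))) < e"
      using B(1) by (simp add: pos_less_divide_eq flip: sum_distrib_right)
  qed
qed

lemma abs_cont_on_Lipschitz:
  assumes "\<And>s t. s \<in> {a..b} \<Longrightarrow> t \<in> {a..b} \<Longrightarrow> norm (g t - g s) \<le> B * \<bar>t - s\<bar>" "B > 0"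
  shows "abs_cont_on {a..b} g"
  unfolding abs_cont_on_def
proof (intro allI impI)
  fix e :: real assume "e > 0"
  show "\<exists>\<delta>>0. \<forall>D S. D division_of S \<and> S \<subseteq> {a..b} \<and> (\<Sum>k\<in>D. Sup k - Inf k) < \<delta> \<longrightarrow>
      (\<Sum>k\<in>D. norm (g (Sup k) - g (Inf k))) < e"
  proof (intro exI[of _ "e / B"] conjI allI impI)
    show "e / B > 0" using \<open>e > 0\<close> \<open>B > 0\<close> by simp
    fix D S assume D: "D division_of S \<and> S \<subseteq> {a..b} \<and> (\<Sum>k\<in>D. Sup k - Inf k) < e / B"
    have "(\<Sum>k\<in>D. norm (g (Sup k) - g (Inf k))) \<le> (\<Sum>k\<in>D. B * (Sup k - Inf k))"
    proof (rule sum_mono)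
      fix K assume "K \<in> D"
      then obtain u v where "K = {u..v}" "u \<le> v" "Inf K = u" "Sup K = v" "K \<subseteq> S"
        using D division_of_realE by blast
      moreover have "u \<in> {a..b}" "v \<in> {a..b}"
        using calculation D by (meson atLeastAtMost_iff order_refl subsetD)+
      ultimately show "norm (g (Sup K) - g (Inf K)) \<le> B * (Sup K - Inf K)"
        using assms(1)[of u v] by simp
    qed
    also have "\<dots> < e"
      using D \<open>B > 0\<close> by (simp add: pos_less_divide_eq mult.commute flip: sum_distrib_left)
    finally show "(\<Sum>k\<in>D. norm (g (Sup k) - g (Inf k))) < e" .
  qed
qed

text \<open>On an interval shorter than the \<open>\<delta>\<close> that belongs to \<open>\<epsilon> = 1\<close>, the variation of \<open>g\<close> over any
  division is below \<open>1\<close>, and a function whose integrals have bounded variation is absolutely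
  integrable. Finitely many short intervals cover \<open>{a..b}\<close>.\<close>

lemma abs_cont_on_absolutely_integrable:
  fixes g :: "real \<Rightarrow> 'b::euclidean_space"
  assumes ac: "abs_cont_on {a..b} g" and "a \<le> b"
    and deriv: "AE t in lebesgue. t \<in> {a..b} \<longrightarrow> (g has_vector_derivative g' t) (at t within {a..b})"
  shows "g' absolutely_integrable_on {a..b}"
proof -
  have int: "(g' has_integral g v - g u) {u..v}" if "u \<le> v" "{u..v} \<subseteq> {a..b}" for u v
  proof (rule abs_cont_on_has_integral)
    show "abs_cont_on {u..v} g" using ac that(2) by (rule abs_cont_on_subset)
    show "AE t in lebesgue. t \<in> {u..v} \<longrightarrow> (g has_vector_derivative g' t) (at t within {u..v})"
      using deriv by eventually_elim (use that in \<open>auto intro: has_vector_derivative_within_subset\<close>)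
  qed fact
  obtain \<delta> where "\<delta> > 0" and \<delta>: "\<And>D S. D division_of S \<Longrightarrow> S \<subseteq> {a..b} \<Longrightarrow>
        (\<Sum>k\<in>D. Sup k - Inf k) < \<delta> \<Longrightarrow> (\<Sum>k\<in>D. norm (g (Sup k) - g (Inf k))) < 1"
    using ac unfolding abs_cont_on_def by (metis zero_less_one)
  have short: "g' absolutely_integrable_on {u..v}"
    if uv: "u \<le> v" "{u..v} \<subseteq> {a..b}" "v - u < \<delta>" for u v
  proof -
    have "g' absolutely_integrable_on cbox u v"
    proof (rule bounded_variation_absolutely_integrable_interval)
      show "g' integrable_on cbox u v"
        using int[OF uv(1,2)] by auto
      show "(\<Sum>K\<in>D. norm (integral K g')) \<le> 1" if D: "D division_of cbox u v" for D
      proof -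
        have "(\<Sum>K\<in>D. Sup K - Inf K) = (\<Sum>K\<in>D. measure lborel K)"
        proof (rule sum.cong)
          show "Sup K - Inf K = measure lborel K" if "K \<in> D" for K
            proof -
            obtain r s where "K = {r..s}" "r \<le> s" "Inf K = r" "Sup K = s" "K \<subseteq> cbox u v"
              by (rule division_of_realE[OF D \<open>K \<in> D\<close>])
            then show ?thesis by simp
          qed
        qed simp
        also have "\<dots> < \<delta>"
          using additive_content_division[OF D] uv by simp
        finally have "(\<Sum>K\<in>D. norm (g (Sup K) - g (Inf K))) < 1"
          using \<delta>[OF D] uv by simp
        moreover have "(\<Sum>K\<in>D. norm (integral K g')) = (\<Sum>K\<in>D. norm (g (Sup K) - g (Inf K)))"
        proof (rule sum.cong)
          show "norm (integral K g') = norm (g (Sup K) - g (Inf K))" if "K \<in> D" for K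
          proof -
            obtain r s where "K = {r..s}" "r \<le> s" "Inf K = r" "Sup K = s" "K \<subseteq> cbox u v"
              by (rule division_of_realE[OF D \<open>K \<in> D\<close>])
            then show ?thesis
              using integral_unique[OF int[of r s]] uv by auto
          qed
        qed simp
        ultimately show ?thesis by simp
      qed
    qed
    then show ?thesis by simp
  qed
  have "u \<le> v \<longrightarrow> {u..v} \<subseteq> {a..b} \<longrightarrow> g' absolutely_integrable_on {u..v}" if "u \<le> v" for u v
    using that
  proof (induction rule: Bolzano)
    case (trans r s t)
    show ?case
    proof (intro impI)
      assume *: "r \<le> t" "{r..t} \<subseteq> {a..b}"
      have "g' absolutely_integrable_on {r..s} \<union> {s..t}"
        using trans * by (intro absolutely_integrable_Un) auto
      moreover have "{r..s} \<union> {s..t} = {r..t}"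
        using trans by auto
      ultimately show "g' absolutely_integrable_on {r..t}" by simp
    qed
  next
    case (local x)
    show ?case
      using short \<open>\<delta> > 0\<close> by (intro exI[of _ \<delta>]) auto
  qed
  then show ?thesis using \<open>a \<le> b\<close> by blast
qed


section \<open>Coordinates on the Heisenberg group\<close>

text \<open>Up to sign, the complex structure on \<open>\<real>\<^sup>2\<^sup>n\<close>; \<open>u \<bullet> rot v\<close> is the symplectic form of the group
  law, and \<open>rot v\<close> is the direction orthogonal to \<open>v\<close> in which a curve has to bend to gain
  height.\<close>

definition rot :: "(real ^ 'n::finite) \<times> (real ^ 'n) \<Rightarrow> (real ^ 'n) \<times> (real ^ 'n)" where
  "rot u = (snd u, - fst u)"

definition vert :: "'n::finite heis \<Rightarrow> real" where
  "vert y = snd (snd y)"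

definition point :: "(real ^ 'n::finite) \<times> (real ^ 'n) \<Rightarrow> real \<Rightarrow> 'n heis" where
  "point u c = (fst u, snd u, c)"

lemma norm_rot [simp]: "norm (rot u) = norm u"
  by (cases u) (simp add: rot_def norm_Pair add.commute)

lemma inner_rot_self [simp]: "u \<bullet> rot u = 0"
  by (cases u) (simp add: rot_def inner_commute)

lemma inner_rot_commute: "u \<bullet> rot v = - (v \<bullet> rot u)"
  by (cases u; cases v) (simp add: rot_def inner_commute)

lemma rot_add: "rot (u + v) = rot u + rot v"
  by (simp add: rot_def)

lemma rot_scaleR: "rot (r *\<^sub>R u) = r *\<^sub>R rot u"
  by (simp add: rot_def)

lemma rot_rot: "rot (rot u) = - u"
  by (cases u) (simp add: rot_def)

lemma bounded_linear_rot: "bounded_linear rot"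
  by (rule bounded_linear_intro[where K=1]) (simp_all add: rot_add rot_scaleR)

lemma abs_inner_rot_le: "\<bar>u \<bullet> rot v\<bar> \<le> norm u * norm v"
  using Cauchy_Schwarz_ineq2[of u "rot v"] by simp

lemma point_hproj_vert: "point (hproj y) (vert y) = y"
  by (cases y) (simp add: point_def vert_def)

lemma hproj_point [simp]: "hproj (point u c) = u"
  by (simp add: point_def)

lemma vert_point [simp]: "vert (point u c) = c"
  by (simp add: point_def vert_def)

lemma heis_mult_point:
  "heis_mult x y = point (hproj x + hproj y) (vert x + vert y - 2 * (hproj x \<bullet> rot (hproj y)))"
  by (cases x; cases y) (simp add: point_def vert_def rot_def)

lemma heis_inv_point: "heis_inv x = point (- hproj x) (- vert x)"
  by (cases x) (simp add: point_def vert_def)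

lemma hfield_point: "hfield h x = point h (2 * (h \<bullet> rot (hproj x)))"
  by (cases x; cases h) (simp add: hfield_eq point_def rot_def)

lemma bounded_linear_hproj: "bounded_linear hproj"
proof -
  have eq: "hproj = (\<lambda>y. (fst y, fst (snd y)))" by (auto simp: fun_eq_iff)
  show ?thesis
    unfolding eq by (intro bounded_linear_Pair bounded_linear_fst
        bounded_linear_compose[OF bounded_linear_fst bounded_linear_snd])
qed

lemma bounded_linear_vert: "bounded_linear vert"
  unfolding vert_def[abs_def]
  by (rule bounded_linear_compose[OF bounded_linear_snd bounded_linear_snd])

text \<open>The linear part of left translation by \<open>x\<close>.\<close>

definition shear :: "'n::finite heis \<Rightarrow> 'n heis \<Rightarrow> 'n heis" where
  "shear x y = point (hproj y) (vert y - 2 * (hproj x \<bullet> rot (hproj y)))"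

lemma heis_mult_shear: "heis_mult x y = x + shear x y"
  by (cases x; cases y) (simp add: heis_mult_point shear_def point_def vert_def)

lemma bounded_linear_shear: "bounded_linear (shear x)"
proof -
  have eq: "shear x = (\<lambda>y. (fst (hproj y), snd (hproj y), vert y - 2 * (hproj x \<bullet> rot (hproj y))))"
    by (auto simp: fun_eq_iff shear_def point_def)
  show ?thesis
    unfolding eq
    by (intro bounded_linear_Pair bounded_linear_sub bounded_linear_const_mult
        bounded_linear_compose[OF bounded_linear_fst bounded_linear_hproj]
        bounded_linear_compose[OF bounded_linear_snd bounded_linear_hproj]
        bounded_linear_vert
        bounded_linear_compose[OF bounded_linear_inner_right
          bounded_linear_compose[OF bounded_linear_rot bounded_linear_hproj]])
qed

text \<open>The horizontal fields are left invariant.\<close>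

lemma shear_hfield: "shear x (hfield h y) = hfield h (heis_mult x y)"
  by (simp add: shear_def hfield_point heis_mult_point rot_add inner_add_right
      inner_rot_commute[of "hproj x" h] algebra_simps)


section \<open>Left invariance and lower bounds for the Carnot-Caratheodory distance\<close>

lemma horizontal_coeffs_translate:
  assumes "horizontal_coeffs I \<gamma> h"
  shows "horizontal_coeffs I (\<lambda>t. heis_mult z (\<gamma> t)) h"
  using assms unfolding horizontal_coeffs_def
proof eventually_elim
  case (elim t)
  show ?case
  proof
    assume "t \<in> I"
    then have "((\<lambda>t. shear z (\<gamma> t)) has_vector_derivative shear z (hfield (h t) (\<gamma> t))) (at t within I)"
      using elim by (intro bounded_linear.has_vector_derivative[OF bounded_linear_shear]) simp
    then have "((\<lambda>t. z + shear z (\<gamma> t)) has_vector_derivative 0 + shear z (hfield (h t) (\<gamma> t))) (at t within I)"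
      by (intro has_vector_derivative_add has_vector_derivative_const)
    then show "((\<lambda>t. heis_mult z (\<gamma> t)) has_vector_derivative hfield (h t) (heis_mult z (\<gamma> t))) (at t within I)"
      by (simp add: heis_mult_shear[of z "\<gamma> _"] shear_hfield)
  qed
qed

lemma horizontal_curve_translate:
  assumes "horizontal_curve I \<gamma>"
  shows "horizontal_curve I (\<lambda>t. heis_mult z (\<gamma> t))"
  using assms horizontal_coeffs_translate abs_cont_on_bounded_linear[OF bounded_linear_shear]
  unfolding horizontal_curve_def heis_mult_shear by blast

definition cc_lengths :: "'n::finite heis \<Rightarrow> 'n heis \<Rightarrow> real set" where
  "cc_lengths x y = {horizontal_length {a..b} \<gamma> |a b \<gamma>.
      a \<le> b \<and> horizontal_curve {a..b} \<gamma> \<and> \<gamma> a = x \<and> \<gamma> b = y}"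

lemma cc_dist_eq: "cc_dist x y = Inf (cc_lengths x y)"
  by (simp add: cc_dist_def cc_lengths_def)

text \<open>A curve and its translate have the same horizontal coefficients, so the same length.\<close>

lemma cc_lengths_translate_subset: "cc_lengths x y \<subseteq> cc_lengths (heis_mult z x) (heis_mult z y)"
proof
  fix l assume "l \<in> cc_lengths x y"
  then obtain a b \<gamma> where *: "l = horizontal_length {a..b} \<gamma>" "a \<le> b" "horizontal_curve {a..b} \<gamma>"
    "\<gamma> a = x" "\<gamma> b = y" unfolding cc_lengths_def by blast
  then obtain h where "horizontal_coeffs {a..b} \<gamma> h"
    unfolding horizontal_curve_def by blast
  then have "l = horizontal_length {a..b} (\<lambda>t. heis_mult z (\<gamma> t))"
    using horizontal_length_eq horizontal_coeffs_translate *(1) by metis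
  then show "l \<in> cc_lengths (heis_mult z x) (heis_mult z y)"
    unfolding cc_lengths_def using * horizontal_curve_translate[OF *(3)] by blast
qed

lemma cc_lengths_translate: "cc_lengths (heis_mult z x) (heis_mult z y) = cc_lengths x y"
proof
  have "heis_mult (heis_inv z) (heis_mult z w) = w" for w
    by (simp add: heis_mult_inv heis_mult_zero flip: heis_mult_assoc)
  then show "cc_lengths (heis_mult z x) (heis_mult z y) \<subseteq> cc_lengths x y"
    using cc_lengths_translate_subset[of "heis_mult z x" "heis_mult z y" "heis_inv z"] by simp
qed (rule cc_lengths_translate_subset)

lemma cc_lengths_origin: "cc_lengths x y = cc_lengths 0 (heis_mult (heis_inv x) y)"
  using cc_lengths_translate[of "heis_inv x" x y] by (simp add: heis_mult_inv)

lemma cc_dist_origin: "cc_dist x y = cc_dist 0 (heis_mult (heis_inv x) y)"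
  by (simp add: cc_dist_eq cc_lengths_origin[of x y])

text \<open>The horizontal part is the integral of the coefficients \<open>h\<close>, so it stays within \<open>l\<close> of its start.
  The height is the integral of \<open>2 * (h \<bullet> rot q)\<close>, where \<open>q\<close> is the horizontal part; with
  \<open>norm q \<le> l\<close> it is at most \<open>2 * l\<close> times the length.\<close>

lemma cc_lengths_lower:
  assumes "l \<in> cc_lengths 0 y"
  shows "norm (hproj y) \<le> l" "\<bar>vert y\<bar> \<le> 2 * l\<^sup>2"
proof -
  obtain a b \<gamma> where l: "l = horizontal_length {a..b} \<gamma>" and "a \<le> b" and
    curve: "horizontal_curve {a..b} \<gamma>" and ends: "\<gamma> a = 0" "\<gamma> b = y"
    using assms unfolding cc_lengths_def by blast
  obtain h where h: "horizontal_coeffs {a..b} \<gamma> h" and ac: "abs_cont_on {a..b} \<gamma>"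
    using curve unfolding horizontal_curve_def by blast
  have proj_0: "hproj 0 = 0" "vert 0 = 0"
    by (simp_all add: linear_0 bounded_linear.linear bounded_linear_hproj bounded_linear_vert)
  have ac_proj: "abs_cont_on {a..b} (\<lambda>t. hproj (\<gamma> t))" and ac_vert: "abs_cont_on {a..b} (\<lambda>t. vert (\<gamma> t))"
    using abs_cont_on_bounded_linear[OF bounded_linear_hproj ac, of 0]
      abs_cont_on_bounded_linear[OF bounded_linear_vert ac, of 0] by simp_all
  have d_proj: "AE t in lebesgue. t \<in> {a..b} \<longrightarrow>
      ((\<lambda>t. hproj (\<gamma> t)) has_vector_derivative h t) (at t within {a..b})"
    using h unfolding horizontal_coeffs_def
    by eventually_elim
      (use bounded_linear.has_vector_derivative[OF bounded_linear_hproj] in \<open>fastforce simp: hproj_hfield\<close>)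
  have d_vert: "AE t in lebesgue. t \<in> {a..b} \<longrightarrow>
      ((\<lambda>t. vert (\<gamma> t)) has_vector_derivative 2 * (h t \<bullet> rot (hproj (\<gamma> t)))) (at t within {a..b})"
    using h unfolding horizontal_coeffs_def
    by eventually_elim
      (use bounded_linear.has_vector_derivative[OF bounded_linear_vert] in \<open>fastforce simp: hfield_point\<close>)
  have "h absolutely_integrable_on {a..b}"
    by (rule abs_cont_on_absolutely_integrable[OF ac_proj \<open>a \<le> b\<close> d_proj])
  then have int_h: "(\<lambda>t. norm (h t)) integrable_on {a..b}"
    by (simp add: absolutely_integrable_on_def)
  have l_eq: "l = integral {a..b} (\<lambda>t. norm (h t))"
    using horizontal_length_eq[OF h] l by simp
  have proj_le: "norm (hproj (\<gamma> t)) \<le> l" if t: "t \<in> {a..b}" for t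
  proof -
    have sub: "{a..t} \<subseteq> {a..b}" using t by auto
    have "(h has_integral hproj (\<gamma> t) - hproj (\<gamma> a)) {a..t}"
    proof (rule abs_cont_on_has_integral)
      show "AE s in lebesgue. s \<in> {a..t} \<longrightarrow>
          ((\<lambda>t. hproj (\<gamma> t)) has_vector_derivative h s) (at s within {a..t})"
        using d_proj by eventually_elim (use sub in \<open>auto intro: has_vector_derivative_within_subset\<close>)
    qed (use ac_proj sub t in \<open>auto intro: abs_cont_on_subset\<close>)
    then have int: "(h has_integral hproj (\<gamma> t)) {a..t}"
      by (simp add: ends proj_0)
    have int_t: "(\<lambda>t. norm (h t)) integrable_on {a..t}"
      using int_h sub by (rule integrable_on_subinterval)
    have "norm (hproj (\<gamma> t)) = norm (integral {a..t} h)"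
      using int by (simp add: integral_unique)
    also have "\<dots> \<le> integral {a..t} (\<lambda>t. norm (h t))"
      using int int_t by (intro Henstock_Kurzweil_Integration.integral_norm_bound_integral) auto
    also have "\<dots> \<le> l"
      unfolding l_eq using sub int_t int_h by (rule integral_subset_le) simp
    finally show ?thesis .
  qed
  from this[of b] show "norm (hproj y) \<le> l"
    using ends \<open>a \<le> b\<close> by simp
  have "((\<lambda>t. 2 * (h t \<bullet> rot (hproj (\<gamma> t)))) has_integral vert (\<gamma> b) - vert (\<gamma> a)) {a..b}"
    by (rule abs_cont_on_has_integral[OF ac_vert \<open>a \<le> b\<close> d_vert])
  then have int: "((\<lambda>t. 2 * (h t \<bullet> rot (hproj (\<gamma> t)))) has_integral vert y) {a..b}"
    by (simp add: ends proj_0)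
  have "\<bar>vert y\<bar> = norm (integral {a..b} (\<lambda>t. 2 * (h t \<bullet> rot (hproj (\<gamma> t)))))"
    by (simp only: integral_unique[OF int] real_norm_def)
  also have "\<dots> \<le> integral {a..b} (\<lambda>t. (2 * l) * norm (h t))"
  proof (rule Henstock_Kurzweil_Integration.integral_norm_bound_integral)
    fix t assume "t \<in> {a..b}"
    have "\<bar>h t \<bullet> rot (hproj (\<gamma> t))\<bar> \<le> norm (h t) * norm (hproj (\<gamma> t))"
      by (rule abs_inner_rot_le)
    also have "\<dots> \<le> norm (h t) * l"
      using proj_le[OF \<open>t \<in> {a..b}\<close>] by (intro mult_left_mono) auto
    finally show "norm (2 * (h t \<bullet> rot (hproj (\<gamma> t)))) \<le> (2 * l) * norm (h t)"
      by (simp add: mult_ac)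
  qed (use int int_h in \<open>auto intro: integrable_on_mult_right\<close>)
  also have "\<dots> = 2 * l\<^sup>2"
    by (simp add: l_eq power2_eq_square)
  finally show "\<bar>vert y\<bar> \<le> 2 * l\<^sup>2" .
qed


section \<open>Explicit horizontal curves and upper bounds for the distance\<close>

text \<open>Continuity of the coefficients bounds the velocity, so the curve is Lipschitz and in particular
  absolutely continuous.\<close>

lemma cc_lengths_C1_curve:
  assumes deriv: "\<And>t. t \<in> {0..1} \<Longrightarrow> (\<gamma> has_vector_derivative hfield (h t) (\<gamma> t)) (at t within {0..1})"
    and cont: "continuous_on {0..1} h"
  shows "integral {0..1} (\<lambda>t. norm (h t)) \<in> cc_lengths (\<gamma> 0) (\<gamma> 1)"
proof -
  have cont_\<gamma>: "continuous_on {0..1} \<gamma>"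
    using deriv by (rule continuous_on_vector_derivative)
  have "continuous_on {0..1} (\<lambda>t. hfield (h t) (\<gamma> t))"
    unfolding hfield_point point_def
    by (intro continuous_intros cont bounded_linear.continuous_on[OF bounded_linear_rot]
        bounded_linear.continuous_on[OF bounded_linear_hproj] cont_\<gamma>)
  then have "compact ((\<lambda>t. hfield (h t) (\<gamma> t)) ` {0..1})"
    by (intro compact_continuous_image compact_Icc)
  then obtain B where B: "B > 0" "\<And>t. t \<in> {0..1} \<Longrightarrow> norm (hfield (h t) (\<gamma> t)) \<le> B"
    using compact_imp_bounded bounded_pos by (metis (no_types, lifting) imageI)
  have "norm (\<gamma> t - \<gamma> s) \<le> B * norm (t - s)" if "s \<in> {0..1}" "t \<in> {0..1}" for s t
  proof (rule differentiable_bound)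
    show "(\<gamma> has_derivative (\<lambda>x. x *\<^sub>R hfield (h u) (\<gamma> u))) (at u within {0..1})" if "u \<in> {0..1}" for u
      using deriv[OF that] by (simp add: has_vector_derivative_def)
    show "onorm (\<lambda>x. x *\<^sub>R hfield (h u) (\<gamma> u)) \<le> B" if "u \<in> {0..1}" for u
    proof (rule onorm_bound)
      show "norm (x *\<^sub>R hfield (h u) (\<gamma> u)) \<le> B * norm x" for x
        using mult_left_mono[OF B(2)[OF that], of "\<bar>x\<bar>"] by (simp add: mult.commute)
    qed (use B in simp)
  qed (use that in auto)
  then have ac: "abs_cont_on {0..1} \<gamma>"
    using B(1) by (intro abs_cont_on_Lipschitz[of 0 1 \<gamma> B]) auto
  have coeffs: "horizontal_coeffs {0..1} \<gamma> h"
    unfolding horizontal_coeffs_def using deriv by simp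
  then have "horizontal_curve {0..1} \<gamma>"
    using ac unfolding horizontal_curve_def by (auto simp: is_interval_cc)
  then show ?thesis
    unfolding cc_lengths_def using horizontal_length_eq[OF coeffs]
    by (intro CollectI exI[of _ 0] exI[of _ 1] exI[of _ \<gamma>]) auto
qed

text \<open>The function \<open>z\<close> is twice the area swept out by the position vector of the plane curve
  \<open>(\<phi>, \<psi>)\<close>. The horizontal curve over \<open>\<phi> v + \<psi> rot v\<close> gains height in proportion to that area.\<close>

lemma cc_lengths_plane_curve:
  fixes v :: "(real ^ 'n::finite) \<times> (real ^ 'n)"
  assumes deriv: "\<And>t. (\<phi> has_real_derivative \<phi>' t) (at t)" "\<And>t. (\<psi> has_real_derivative \<psi>' t) (at t)"
    "\<And>t. (z has_real_derivative \<psi>' t * \<phi> t - \<phi>' t * \<psi> t) (at t)"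
    and cont: "continuous_on {0..1} \<phi>'" "continuous_on {0..1} \<psi>'"
    and start: "\<phi> 0 = 0" "\<psi> 0 = 0" "z 0 = 0"
    and speed: "\<And>t. t \<in> {0..1} \<Longrightarrow> (\<phi>' t)\<^sup>2 + (\<psi>' t)\<^sup>2 \<le> m\<^sup>2" and "m \<ge> 0"
  shows "\<exists>l \<in> cc_lengths 0 (point (\<phi> 1 *\<^sub>R v + \<psi> 1 *\<^sub>R rot v) (2 * (norm v)\<^sup>2 * z 1)). l \<le> norm v * m"
proof -
  define q where "q t = \<phi> t *\<^sub>R v + \<psi> t *\<^sub>R rot v" for t
  define h where "h t = \<phi>' t *\<^sub>R v + \<psi>' t *\<^sub>R rot v" for t
  define \<gamma> where "\<gamma> t = point (q t) (2 * (norm v)\<^sup>2 * z t)" for t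
  have vv: "v \<bullet> v = (norm v)\<^sup>2" "rot v \<bullet> rot v = (norm v)\<^sup>2"
    by (simp_all add: dot_square_norm)
  have area: "h t \<bullet> rot (q t) = (norm v)\<^sup>2 * (\<psi>' t * \<phi> t - \<phi>' t * \<psi> t)" for t
    unfolding h_def q_def
    by (simp add: rot_add rot_scaleR rot_rot inner_add_left inner_add_right vv
        inner_commute[of "rot v" v] algebra_simps)
  have norm_h: "norm (h t) \<le> norm v * m" if "t \<in> {0..1}" for t
  proof (rule power2_le_imp_le)
    have "(norm (h t))\<^sup>2 = (norm v)\<^sup>2 * ((\<phi>' t)\<^sup>2 + (\<psi>' t)\<^sup>2)"
      unfolding h_def power2_norm_eq_inner
      by (simp add: inner_add_left inner_add_right vv inner_commute[of "rot v" v]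
        power2_eq_square algebra_simps)
    also have "\<dots> \<le> (norm v)\<^sup>2 * m\<^sup>2"
      by (intro mult_left_mono speed that) simp
    finally show "(norm (h t))\<^sup>2 \<le> (norm v * m)\<^sup>2"
      by (simp add: power_mult_distrib)
  qed (simp add: \<open>m \<ge> 0\<close>)
  have "(q has_vector_derivative h t) (at t within {0..1})" for t
  proof -
    have "((\<lambda>t. \<phi> t *\<^sub>R v + \<psi> t *\<^sub>R rot v) has_vector_derivative
        (\<phi> t *\<^sub>R 0 + \<phi>' t *\<^sub>R v) + (\<psi> t *\<^sub>R 0 + \<psi>' t *\<^sub>R rot v)) (at t within {0..1})"
      by (intro has_vector_derivative_add has_vector_derivative_scaleR has_vector_derivative_const
          deriv[THEN has_field_derivative_at_within])
    then show ?thesis by (simp add: q_def[abs_def] h_def)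
  qed
  moreover have "((\<lambda>t. 2 * (norm v)\<^sup>2 * z t) has_vector_derivative 2 * (h t \<bullet> rot (q t))) (at t within {0..1})" for t
    unfolding area has_real_derivative_iff_has_vector_derivative[symmetric]
    by (auto intro!: derivative_eq_intros deriv(3)[THEN has_field_derivative_at_within])
  ultimately have "(\<gamma> has_vector_derivative hfield (h t) (\<gamma> t)) (at t within {0..1})" for t
    unfolding \<gamma>_def[abs_def] hfield_point hproj_point unfolding point_def
    by (intro has_vector_derivative_Pair bounded_linear.has_vector_derivative[OF bounded_linear_fst]
        bounded_linear.has_vector_derivative[OF bounded_linear_snd])
  moreover have cont_h: "continuous_on {0..1} h"
    unfolding h_def[abs_def] by (intro continuous_intros cont)
  ultimately have "integral {0..1} (\<lambda>t. norm (h t)) \<in> cc_lengths (\<gamma> 0) (\<gamma> 1)"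
    by (intro cc_lengths_C1_curve)
  moreover have "integral {0..1} (\<lambda>t. norm (h t)) \<le> integral {0..1} (\<lambda>t::real. norm v * m)"
    using norm_h by (intro integral_le integrable_continuous_interval continuous_intros cont_h) auto
  moreover have "\<gamma> 0 = 0"
    by (simp add: \<gamma>_def q_def start point_def zero_prod_def)
  ultimately show ?thesis
    by (auto simp: \<gamma>_def q_def)
qed

text \<open>The parabolic arc \<open>t v + k t (1 - t) rot v\<close> ends in \<open>v\<close> and encloses with its chord an area
  proportional to \<open>k\<close>, so \<open>k\<close> is a multiple of \<open>c / (norm v)\<^sup>2\<close>. Its speed
  \<open>norm v * sqrt (1 + k\<^sup>2 (1 - 2 t)\<^sup>2)\<close> exceeds \<open>norm v\<close> only to second order in \<open>k\<close>.\<close>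

lemma cc_lengths_arc:
  assumes "v \<noteq> 0"
  shows "\<exists>l \<in> cc_lengths 0 (point v c). l \<le> norm v * (1 + 9 / 8 * (c / (norm v)\<^sup>2)\<^sup>2)"
proof -
  define k where "k = - 3 * c / (2 * (norm v)\<^sup>2)"
  let ?\<phi> = "\<lambda>t::real. t" and ?\<psi> = "\<lambda>t. k * t * (1 - t)" and ?z = "\<lambda>t. - k * t ^ 3 / 3"
  have m: "9 / 8 * (c / (norm v)\<^sup>2)\<^sup>2 = k\<^sup>2 / 2"
    using assms by (simp add: k_def power_divide power_mult_distrib field_simps)
  have "\<exists>l \<in> cc_lengths 0 (point (?\<phi> 1 *\<^sub>R v + ?\<psi> 1 *\<^sub>R rot v) (2 * (norm v)\<^sup>2 * ?z 1)).
      l \<le> norm v * (1 + k\<^sup>2 / 2)"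
  proof (rule cc_lengths_plane_curve[where \<phi> = ?\<phi> and \<psi> = ?\<psi> and z = ?z
        and \<phi>' = "\<lambda>_. 1" and \<psi>' = "\<lambda>t. k * (1 - 2 * t)" and m = "1 + k\<^sup>2 / 2"])
    show "(?\<phi> has_real_derivative 1) (at t)" for t by simp
    show "(?\<psi> has_real_derivative k * (1 - 2 * t)) (at t)" for t
      by (auto intro!: derivative_eq_intros simp: algebra_simps)
    show "(?z has_real_derivative k * (1 - 2 * t) * t - 1 * (k * t * (1 - t))) (at t)" for t
      by (auto intro!: derivative_eq_intros simp: algebra_simps power2_eq_square)
    show "1\<^sup>2 + (k * (1 - 2 * t))\<^sup>2 \<le> (1 + k\<^sup>2 / 2)\<^sup>2" if "t \<in> {0..1}" for t
    proof -
      have "(1 - 2 * t)\<^sup>2 \<le> 1"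
        using that by (simp add: abs_square_le_1 abs_le_iff)
      then have "k\<^sup>2 * (1 - 2 * t)\<^sup>2 \<le> k\<^sup>2"
        by (simp add: mult_left_le)
      then show ?thesis
        unfolding power_mult_distrib by (simp add: power2_sum add_increasing)
    qed
  qed (auto intro!: continuous_intros)
  moreover have "2 * (norm v)\<^sup>2 * ?z 1 = c"
    using assms by (simp add: k_def)
  ultimately show ?thesis
    unfolding m by simp
qed

text \<open>Points on the vertical axis, which the arc does not reach, are the ends of lifts of the closed
  plane curve \<open>(t (1 - t), k t\<^sup>2 (1 - t))\<close>. Nonemptiness is what makes \<open>Inf\<close> in \<open>cc_dist\<close> the greatest
  lower bound.\<close>

lemma cc_lengths_nonempty: "cc_lengths x y \<noteq> {}"
proof -
  have "cc_lengths 0 (point v c) \<noteq> {}" for v :: "(real ^ 'a) \<times> (real ^ 'a)" and c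
  proof (cases "v = 0")
    case False
    then show ?thesis using cc_lengths_arc by fastforce
  next
    case True
    define e :: "(real ^ 'a) \<times> (real ^ 'a)" where "e = (axis undefined 1, 0)"
    have "norm e = 1" by (simp add: e_def norm_Pair)
    \<comment> \<open>The area integral \<open>z\<close> of the loop is \<open>k / 30\<close>, and the height gained is twice that.\<close>
    define k where "k = 15 * c"
    let ?\<phi> = "\<lambda>t::real. t * (1 - t)" and ?\<psi> = "\<lambda>t. k * t\<^sup>2 * (1 - t)"
      and ?z = "\<lambda>t. k * (t ^ 3 / 3 - t ^ 4 / 2 + t ^ 5 / 5)"
    have "\<exists>l \<in> cc_lengths 0 (point (?\<phi> 1 *\<^sub>R e + ?\<psi> 1 *\<^sub>R rot e) (2 * (norm e)\<^sup>2 * ?z 1)).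
        l \<le> norm e * (1 + 2 * \<bar>k\<bar>)"
    proof (rule cc_lengths_plane_curve[where \<phi> = ?\<phi> and \<psi> = ?\<psi> and z = ?z
          and \<phi>' = "\<lambda>t. 1 - 2 * t" and \<psi>' = "\<lambda>t. k * (2 * t - 3 * t\<^sup>2)"
          and m = "1 + 2 * \<bar>k\<bar>"])
      show "(?\<phi> has_real_derivative 1 - 2 * t) (at t)" for t
        by (auto intro!: derivative_eq_intros)
      show "(?\<psi> has_real_derivative k * (2 * t - 3 * t\<^sup>2)) (at t)" for t
        by (auto intro!: derivative_eq_intros simp: algebra_simps power2_eq_square)
      show "(?z has_real_derivative k * (2 * t - 3 * t\<^sup>2) * (t * (1 - t)) - (1 - 2 * t) * (k * t\<^sup>2 * (1 - t))) (at t)" for t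
        by (auto intro!: derivative_eq_intros simp: algebra_simps eval_nat_numeral)
      show "(1 - 2 * t)\<^sup>2 + (k * (2 * t - 3 * t\<^sup>2))\<^sup>2 \<le> (1 + 2 * \<bar>k\<bar>)\<^sup>2" if "t \<in> {0..1}" for t
      proof -
        have "(1 - 2 * t)\<^sup>2 \<le> 1"
          using that by (simp add: abs_square_le_1 abs_le_iff)
        moreover have "\<bar>2 * t - 3 * t\<^sup>2\<bar> \<le> 2"
        proof -
          have "t\<^sup>2 \<le> t" using that by (simp add: power2_eq_square mult_left_le)
          moreover have "0 \<le> t\<^sup>2" "0 \<le> t" "t \<le> 1" using that by simp_all
          ultimately show ?thesis by (intro abs_leI) linarith+
        qed
        then have "(2 * t - 3 * t\<^sup>2)\<^sup>2 \<le> 2\<^sup>2"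
          by (rule abs_le_square_iff[THEN iffD1, OF order_trans]) simp
        then have "k\<^sup>2 * (2 * t - 3 * t\<^sup>2)\<^sup>2 \<le> k\<^sup>2 * 4"
          by (intro mult_left_mono) auto
        ultimately show ?thesis
          unfolding power_mult_distrib by (simp add: power2_sum power_mult_distrib)
      qed
    qed (auto intro!: continuous_intros)
    moreover have "2 * (norm e)\<^sup>2 * ?z 1 = c"
      by (simp add: \<open>norm e = 1\<close> k_def)
    ultimately show ?thesis
      using True by auto
  qed
  from this[of "hproj (heis_mult (heis_inv x) y)" "vert (heis_mult (heis_inv x) y)"] show ?thesis
    unfolding point_hproj_vert using cc_lengths_origin[of x y] by simp
qed

lemma cc_lengths_nonneg: "l \<in> cc_lengths x y \<Longrightarrow> 0 \<le> l"
  using cc_lengths_lower(1) norm_ge_zero order_trans unfolding cc_lengths_origin[of x y] by blast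

lemma cc_dist_nonneg: "0 \<le> cc_dist x y"
  unfolding cc_dist_eq by (rule cInf_greatest[OF cc_lengths_nonempty cc_lengths_nonneg])

lemma cc_dist_le: "l \<in> cc_lengths x y \<Longrightarrow> cc_dist x y \<le> l"
  unfolding cc_dist_eq by (rule cInf_lower) (auto intro: bdd_belowI cc_lengths_nonneg)

lemma norm_hproj_le_cc_dist: "norm (hproj y) \<le> cc_dist 0 y"
  unfolding cc_dist_eq by (rule cInf_greatest[OF cc_lengths_nonempty cc_lengths_lower(1)])

lemma abs_vert_le_cc_dist: "\<bar>vert y\<bar> \<le> 2 * (cc_dist 0 y)\<^sup>2"
proof -
  have "sqrt (\<bar>vert y\<bar> / 2) \<le> cc_dist 0 y"
    unfolding cc_dist_eq
  proof (rule cInf_greatest[OF cc_lengths_nonempty])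
    fix l assume l: "l \<in> cc_lengths 0 y"
    show "sqrt (\<bar>vert y\<bar> / 2) \<le> l"
      using cc_lengths_lower(2)[OF l] cc_lengths_nonneg[OF l] by (intro real_le_lsqrt) auto
  qed
  then have "\<bar>vert y\<bar> / 2 \<le> (cc_dist 0 y)\<^sup>2"
    by (rule sqrt_le_D)
  then show ?thesis by simp
qed

lemma cc_dist_arc_le:
  assumes "v \<noteq> 0"
  shows "cc_dist 0 (point v c) \<le> norm v * (1 + 9 / 8 * (c / (norm v)\<^sup>2)\<^sup>2)"
  using cc_lengths_arc[OF assms, of c] cc_dist_le order_trans by blast

text \<open>Here \<open>point w d\<close> is a small perturbation of the point reached from \<open>0\<close> after time \<open>t = K * r\<close> in the
  direction \<open>e\<close>. The quotient \<open>point u \<beta>\<close> of the two points has \<open>norm u \<le> t - p \<bullet> e + O(r / K)\<close>, by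
  expanding \<open>norm (p - t e)\<close>, and \<open>\<beta> = O(t r)\<close>. The relative height \<open>\<beta> / (norm u)\<^sup>2\<close> is thus
  \<open>O(1 / K)\<close>, and the arc over \<open>u\<close> is longer than \<open>norm u\<close> by \<open>O(t / K\<^sup>2) = O(r / K)\<close>.\<close>

lemma cc_dist_from_far_point:
  assumes e: "norm e = 1" and p: "norm p \<le> r" and c: "\<bar>c\<bar> \<le> r\<^sup>2" and "r > 0" and "K \<ge> 4"
    and w: "norm (w - (K * r) *\<^sub>R e) \<le> r / K" and d: "\<bar>d\<bar> \<le> r\<^sup>2"
  shows "cc_dist (point w d) (point p c) \<le> K * r - p \<bullet> e + 326 * r / K"
proof -
  define t where "t = K * r"
  have "K > 0" using \<open>K \<ge> 4\<close> by simp
  have "t > 0" using \<open>K > 0\<close> \<open>r > 0\<close> by (simp add: t_def)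
  have t4: "4 * r \<le> t" using \<open>K \<ge> 4\<close> \<open>r > 0\<close> by (simp add: t_def)
  have rK: "r / K \<le> r / 4" using \<open>K \<ge> 4\<close> \<open>r > 0\<close> by (intro divide_left_mono) auto
  define u where "u = p - w"
  define \<beta> where "\<beta> = c - d + 2 * (w \<bullet> rot p)"
  have mult: "heis_mult (heis_inv (point w d)) (point p c) = point u \<beta>"
    by (simp add: heis_inv_point heis_mult_point u_def \<beta>_def)
  have pe: "\<bar>p \<bullet> e\<bar> \<le> r"
    using Cauchy_Schwarz_ineq2[of p e] e p by simp
  define m where "m = t - p \<bullet> e"
  have m: "t / 2 \<le> m" "0 < m" using pe t4 \<open>t > 0\<close> by (auto simp: m_def)
  have pte: "norm (p - t *\<^sub>R e) \<le> m + r / K"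
  proof (rule power2_le_imp_le)
    have "(norm (p - t *\<^sub>R e))\<^sup>2 = (norm p)\<^sup>2 - 2 * t * (p \<bullet> e) + t\<^sup>2"
      using e unfolding power2_norm_eq_inner norm_eq_1
      by (simp add: inner_diff_left inner_diff_right inner_commute[of e p] power2_eq_square[of t] right_diff_distrib)
    also have "\<dots> \<le> m\<^sup>2 + (norm p)\<^sup>2"
      by (simp add: m_def power2_diff algebra_simps)
    also have "(norm p)\<^sup>2 \<le> r\<^sup>2"
      using p by (simp add: power_mono)
    also have "r\<^sup>2 = t * (r / K)"
      using \<open>K > 0\<close> by (simp add: t_def power2_eq_square)
    also have "\<dots> \<le> 2 * m * (r / K)"
      using m \<open>K > 0\<close> \<open>r > 0\<close> by (intro mult_right_mono) auto
    also have "m\<^sup>2 + 2 * m * (r / K) \<le> (m + r / K)\<^sup>2"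
      by (simp add: power2_sum)
    finally show "(norm (p - t *\<^sub>R e))\<^sup>2 \<le> (m + r / K)\<^sup>2" by simp
  qed (use m \<open>K > 0\<close> \<open>r > 0\<close> in simp)
  have u_eq: "u = (p - t *\<^sub>R e) - (w - t *\<^sub>R e)" by (simp add: u_def)
  have u_le: "norm u \<le> m + 2 * (r / K)"
    unfolding u_eq using norm_triangle_ineq4[of "p - t *\<^sub>R e" "w - t *\<^sub>R e"] pte w
    by (simp add: t_def)
  then have u_le2: "norm u \<le> 2 * t"
    using pe t4 rK \<open>t > 0\<close> by (simp add: m_def)
  have u_ge: "t / 2 \<le> norm u"
  proof -
    have "t = norm (t *\<^sub>R e)" using e \<open>t > 0\<close> by simp
    also have "t *\<^sub>R e = p - u - (w - t *\<^sub>R e)" by (simp add: u_def)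
    also have "norm \<dots> \<le> norm p + norm u + norm (w - t *\<^sub>R e)"
      by (intro order_trans[OF norm_triangle_ineq4] add_right_mono norm_triangle_ineq4)
    also have "\<dots> \<le> norm p + norm u + r / K" using w by (simp add: t_def)
    finally show ?thesis using p t4 rK \<open>t > 0\<close> by linarith
  qed
  have "u \<noteq> 0" using u_ge \<open>t > 0\<close> by auto
  have w_le: "norm w \<le> 5 / 4 * t"
  proof -
    have "norm w \<le> norm (t *\<^sub>R e) + norm (w - t *\<^sub>R e)"
      using norm_triangle_ineq[of "t *\<^sub>R e" "w - t *\<^sub>R e"] by simp
    also have "norm (t *\<^sub>R e) = t" using e \<open>t > 0\<close> by simp
    also have "norm (w - t *\<^sub>R e) \<le> r / K" using w by (simp add: t_def)
    finally show ?thesis using rK t4 \<open>t > 0\<close> by linarith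
  qed
  have \<beta>_le: "\<bar>\<beta>\<bar> \<le> 3 * t * r"
  proof -
    have "\<bar>w \<bullet> rot p\<bar> \<le> norm w * norm p" by (rule abs_inner_rot_le)
    also have "\<dots> \<le> (5 / 4 * t) * r"
      using w_le p \<open>t > 0\<close> by (intro mult_mono) auto
    finally have 1: "\<bar>w \<bullet> rot p\<bar> \<le> 5 / 4 * t * r" .
    have "r\<^sup>2 \<le> t * r / 4"
      using t4 \<open>r > 0\<close> by (simp add: power2_eq_square)
    then show ?thesis using 1 c d unfolding \<beta>_def by linarith
  qed
  have "\<bar>\<beta> / (norm u)\<^sup>2\<bar> \<le> 12 / K"
  proof -
    have "(t / 2)\<^sup>2 \<le> (norm u)\<^sup>2"
      using u_ge \<open>t > 0\<close> by (intro power_mono) auto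
    then have "\<bar>\<beta>\<bar> / (norm u)\<^sup>2 \<le> (3 * t * r) / (t / 2)\<^sup>2"
      using \<beta>_le \<open>t > 0\<close> \<open>r > 0\<close> by (intro frac_le) auto
    also have "\<dots> = 12 / K"
      using \<open>r > 0\<close> \<open>K > 0\<close> by (simp add: t_def power2_eq_square field_simps)
    finally show ?thesis by simp
  qed
  then have "(\<beta> / (norm u)\<^sup>2)\<^sup>2 \<le> (12 / K)\<^sup>2"
    by (rule abs_le_square_iff[THEN iffD1, OF order_trans]) (use \<open>K > 0\<close> in simp)
  then have "9 / 8 * (\<beta> / (norm u)\<^sup>2)\<^sup>2 * norm u \<le> 9 / 8 * (12 / K)\<^sup>2 * (2 * t)"
    using u_le2 by (intro mult_mono mult_left_mono) auto
  also have "\<dots> = 324 * (r / K)"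
    using \<open>K > 0\<close> by (simp add: t_def power2_eq_square)
  finally have excess: "9 / 8 * (\<beta> / (norm u)\<^sup>2)\<^sup>2 * norm u \<le> 324 * (r / K)" .
  have "cc_dist (point w d) (point p c) = cc_dist 0 (point u \<beta>)"
    by (subst cc_dist_origin) (simp only: mult)
  also have "\<dots> \<le> norm u * (1 + 9 / 8 * (\<beta> / (norm u)\<^sup>2)\<^sup>2)"
    by (rule cc_dist_arc_le[OF \<open>u \<noteq> 0\<close>])
  also have "\<dots> = norm u + 9 / 8 * (\<beta> / (norm u)\<^sup>2)\<^sup>2 * norm u"
    by (simp only: distrib_left mult_1_right mult.commute)
  also have "\<dots> \<le> m + 326 * (r / K)"
    using u_le excess by linarith
  finally show ?thesis
    by (simp add: m_def t_def)
qed


section \<open>Tangents of Lipschitz curves\<close>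

text \<open>The interval from \<open>0\<close> to \<open>t\<close> is cut into \<open>N\<close> equal pieces. Over one piece, the height of the group
  increment is at most \<open>2 * (C * \<bar>t\<bar> / N)\<^sup>2\<close> by the Lipschitz condition; it differs from the increment
  of the height by twice the symplectic form of the two end points, which is \<open>O(\<eta> t\<^sup>2)\<close> because both are
  close to the line spanned by \<open>e\<close>, on which that form vanishes.\<close>

lemma vert_lipschitz_curve:
  fixes \<sigma> :: "real \<Rightarrow> 'n::finite heis"
  assumes lip: "\<And>s t. s \<in> J \<Longrightarrow> t \<in> J \<Longrightarrow> cc_dist (\<sigma> s) (\<sigma> t) \<le> C * \<bar>s - t\<bar>"
    and "\<sigma> 0 = 0" and J: "\<And>s. \<bar>s\<bar> \<le> \<bar>t\<bar> \<Longrightarrow> s \<in> J"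
    and e: "norm e = 1"
    and close: "\<And>s. \<bar>s\<bar> \<le> \<bar>t\<bar> \<Longrightarrow> norm (hproj (\<sigma> s) - s *\<^sub>R e) \<le> \<eta> * \<bar>t\<bar>" and "0 \<le> \<eta>" "\<eta> \<le> 1"
    and "N > 0"
  shows "\<bar>vert (\<sigma> t)\<bar> \<le> (2 * C\<^sup>2 / real N + 6 * real N * \<eta>) * t\<^sup>2"
proof -
  define s where "s k = real k / real N * t" for k
  have s_le: "\<bar>s k\<bar> \<le> \<bar>t\<bar>" if "k \<le> N" for k
  proof -
    have "\<bar>s k\<bar> = (real k / real N) * \<bar>t\<bar>" by (simp add: s_def abs_mult)
    also have "\<dots> \<le> 1 * \<bar>t\<bar>" using that \<open>N > 0\<close> by (intro mult_right_mono) auto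
    finally show ?thesis by simp
  qed
  have step: "\<bar>vert (\<sigma> (s (Suc k))) - vert (\<sigma> (s k))\<bar> \<le> (2 * C\<^sup>2 / (real N)\<^sup>2 + 6 * \<eta>) * t\<^sup>2"
    if "k < N" for k
  proof -
    let ?P = "hproj (\<sigma> (s k))" and ?Q = "hproj (\<sigma> (s (Suc k)))"
    define a where "a = ?P - s k *\<^sub>R e"
    define b where "b = ?Q - s (Suc k) *\<^sub>R e"
    have le: "\<bar>s k\<bar> \<le> \<bar>t\<bar>" "\<bar>s (Suc k)\<bar> \<le> \<bar>t\<bar>" using s_le that by auto
    have ab: "norm a \<le> \<eta> * \<bar>t\<bar>" "norm b \<le> \<eta> * \<bar>t\<bar>"
      unfolding a_def b_def using le close by auto
    have "\<bar>vert (heis_mult (heis_inv (\<sigma> (s k))) (\<sigma> (s (Suc k))))\<bar> \<le> 2 * (cc_dist (\<sigma> (s k)) (\<sigma> (s (Suc k))))\<^sup>2"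
      using abs_vert_le_cc_dist cc_dist_origin by metis
    also have "\<dots> \<le> 2 * (C * \<bar>s k - s (Suc k)\<bar>)\<^sup>2"
      using lip[OF J[OF le(1)] J[OF le(2)]] by (intro mult_left_mono power_mono cc_dist_nonneg) auto
    also have "\<bar>s k - s (Suc k)\<bar> = \<bar>t\<bar> / real N"
    proof -
      have "s k - s (Suc k) = - (t / real N)"
        using \<open>N > 0\<close> by (simp add: s_def field_simps)
      then show ?thesis by (simp add: abs_divide)
    qed
    finally have 1: "\<bar>vert (\<sigma> (s (Suc k))) - vert (\<sigma> (s k)) + 2 * (?P \<bullet> rot ?Q)\<bar> \<le> 2 * C\<^sup>2 / (real N)\<^sup>2 * t\<^sup>2"
      by (simp add: heis_inv_point heis_mult_point power_mult_distrib power_divide)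
    have "?P = s k *\<^sub>R e + a" "?Q = s (Suc k) *\<^sub>R e + b" by (simp_all add: a_def b_def)
    then have "?P \<bullet> rot ?Q = s k * (e \<bullet> rot b) + s (Suc k) * (a \<bullet> rot e) + a \<bullet> rot b"
      by (simp add: rot_add rot_scaleR inner_add_left inner_add_right)
    also have "\<bar>\<dots>\<bar> \<le> \<bar>s k\<bar> * \<bar>e \<bullet> rot b\<bar> + \<bar>s (Suc k)\<bar> * \<bar>a \<bullet> rot e\<bar> + \<bar>a \<bullet> rot b\<bar>"
      unfolding abs_mult[symmetric] by linarith
    also have "\<dots> \<le> \<bar>t\<bar> * (\<eta> * \<bar>t\<bar>) + \<bar>t\<bar> * (\<eta> * \<bar>t\<bar>) + (\<eta> * \<bar>t\<bar>) * \<bar>t\<bar>"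
    proof (intro add_mono mult_mono)
      show "\<bar>e \<bullet> rot b\<bar> \<le> \<eta> * \<bar>t\<bar>" "\<bar>a \<bullet> rot e\<bar> \<le> \<eta> * \<bar>t\<bar>"
        using abs_inner_rot_le[of e b] abs_inner_rot_le[of a e] e ab by auto
      have "norm b \<le> \<bar>t\<bar>"
        using ab(2) mult_right_mono[OF \<open>\<eta> \<le> 1\<close>, of "\<bar>t\<bar>"] by simp
      then have "norm a * norm b \<le> (\<eta> * \<bar>t\<bar>) * \<bar>t\<bar>"
        using ab(1) \<open>0 \<le> \<eta>\<close> by (intro mult_mono) auto
      then show "\<bar>a \<bullet> rot b\<bar> \<le> (\<eta> * \<bar>t\<bar>) * \<bar>t\<bar>"
        using abs_inner_rot_le[of a b] by simp
    qed (use le in auto)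
    also have "\<dots> = 3 * \<eta> * t\<^sup>2"
      by (simp add: power2_eq_square flip: abs_mult)
    finally have "\<bar>?P \<bullet> rot ?Q\<bar> \<le> 3 * \<eta> * t\<^sup>2" .
    then have "\<bar>vert (\<sigma> (s (Suc k))) - vert (\<sigma> (s k))\<bar> \<le> 2 * C\<^sup>2 / (real N)\<^sup>2 * t\<^sup>2 + 6 * \<eta> * t\<^sup>2"
      using 1 by linarith
    then show ?thesis by (simp add: distrib_right)
  qed
  have "s 0 = 0" "s N = t" using \<open>N > 0\<close> by (simp_all add: s_def)
  have "vert (\<sigma> (s N)) - vert (\<sigma> (s 0)) = (\<Sum>k<N. vert (\<sigma> (s (Suc k))) - vert (\<sigma> (s k)))"
    by (rule sum_lessThan_telescope[symmetric])
  moreover have "vert (\<sigma> (s 0)) = 0"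
    using \<open>s 0 = 0\<close> \<open>\<sigma> 0 = 0\<close> by (simp add: linear_0 bounded_linear.linear bounded_linear_vert)
  ultimately have "\<bar>vert (\<sigma> t)\<bar> = \<bar>\<Sum>k<N. vert (\<sigma> (s (Suc k))) - vert (\<sigma> (s k))\<bar>"
    using \<open>s N = t\<close> by simp
  also have "\<dots> \<le> (\<Sum>k<N. (2 * C\<^sup>2 / (real N)\<^sup>2 + 6 * \<eta>) * t\<^sup>2)"
    using step by (intro order_trans[OF sum_abs] sum_mono) auto
  also have "\<dots> = (2 * C\<^sup>2 / real N + 6 * real N * \<eta>) * t\<^sup>2"
    using \<open>N > 0\<close> by (simp add: field_simps power2_eq_square)
  finally show ?thesis .
qed

text \<open>In the bound of \<open>vert_lipschitz_curve\<close>, the number \<open>N\<close> of pieces is chosen first to make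
  \<open>2 * C\<^sup>2 / N\<close> small, and then differentiability provides an \<open>\<eta>\<close> small compared to \<open>1 / N\<close>.\<close>

lemma lipschitz_curve_tangent:
  fixes \<gamma> :: "real \<Rightarrow> 'n::finite heis"
  assumes lip: "lipschitz_curve I \<gamma>" and t0: "t\<^sub>0 \<in> interior I"
    and deriv: "(\<gamma> has_vector_derivative E') (at t\<^sub>0)" and e: "norm (hproj E') = 1" and "\<epsilon> > 0"
  shows "\<exists>\<tau>>0. \<forall>t. \<bar>t\<bar> < \<tau> \<longrightarrow>
    norm (hproj (heis_mult (heis_inv (\<gamma> t\<^sub>0)) (\<gamma> (t\<^sub>0 + t))) - t *\<^sub>R hproj E') \<le> \<epsilon> * \<bar>t\<bar> \<and>
    \<bar>vert (heis_mult (heis_inv (\<gamma> t\<^sub>0)) (\<gamma> (t\<^sub>0 + t)))\<bar> \<le> \<epsilon> * t\<^sup>2"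
proof -
  define \<sigma> where "\<sigma> t = heis_mult (heis_inv (\<gamma> t\<^sub>0)) (\<gamma> (t\<^sub>0 + t))" for t
  obtain C where C: "\<And>s t. s \<in> I \<Longrightarrow> t \<in> I \<Longrightarrow> cc_dist (\<gamma> s) (\<gamma> t) \<le> C * \<bar>s - t\<bar>"
    using lip unfolding lipschitz_curve_def by blast
  obtain r where "r > 0" and r: "ball t\<^sub>0 r \<subseteq> I"
    using t0 mem_interior by blast
  have lip_\<sigma>: "cc_dist (\<sigma> s) (\<sigma> t) \<le> C * \<bar>s - t\<bar>" if "\<bar>s\<bar> < r" "\<bar>t\<bar> < r" for s t
  proof -
    have "t\<^sub>0 + s \<in> I" "t\<^sub>0 + t \<in> I" using r that by (auto simp: subset_iff dist_real_def)
    then show ?thesis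
      using C[of "t\<^sub>0 + s" "t\<^sub>0 + t"] by (simp add: \<sigma>_def cc_dist_eq cc_lengths_translate)
  qed
  have hproj_\<sigma>: "hproj (\<sigma> t) = hproj (\<gamma> (t\<^sub>0 + t) - \<gamma> t\<^sub>0)" for t
    by (simp add: \<sigma>_def heis_mult_point heis_inv_point linear_diff bounded_linear.linear bounded_linear_hproj)
  obtain N :: nat where "N > 0" and N: "2 * C\<^sup>2 / real N \<le> \<epsilon> / 2"
  proof -
    obtain N :: nat where "4 * C\<^sup>2 / \<epsilon> < real N" using reals_Archimedean2 by blast
    moreover have "0 \<le> 4 * C\<^sup>2 / \<epsilon>" using \<open>\<epsilon> > 0\<close> by simp
    ultimately have "0 < real N" by linarith
    with \<open>4 * C\<^sup>2 / \<epsilon> < real N\<close> have "N > 0" "2 * C\<^sup>2 / real N \<le> \<epsilon> / 2"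
      using \<open>\<epsilon> > 0\<close> by (auto simp: field_simps)
    then show thesis by (rule that)
  qed
  define \<eta> where "\<eta> = min 1 (min \<epsilon> (\<epsilon> / (12 * real N)))"
  have \<eta>: "\<eta> > 0" "\<eta> \<le> 1" "\<eta> \<le> \<epsilon>" "6 * real N * \<eta> \<le> \<epsilon> / 2"
  proof -
    have "\<eta> \<le> \<epsilon> / (12 * real N)" by (simp add: \<eta>_def)
    then show "6 * real N * \<eta> \<le> \<epsilon> / 2" using \<open>N > 0\<close> by (simp add: field_simps)
  qed (use \<open>\<epsilon> > 0\<close> \<open>N > 0\<close> in \<open>auto simp: \<eta>_def\<close>)
  have "((\<lambda>t. hproj (\<gamma> t)) has_vector_derivative hproj E') (at t\<^sub>0)"
    by (rule bounded_linear.has_vector_derivative[OF bounded_linear_hproj deriv])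
  then obtain d where "d > 0" and d: "\<And>s. norm (s - t\<^sub>0) < d \<Longrightarrow>
      norm (hproj (\<gamma> s) - hproj (\<gamma> t\<^sub>0) - (s - t\<^sub>0) *\<^sub>R hproj E') \<le> \<eta> * norm (s - t\<^sub>0)"
    using \<eta>(1) unfolding has_vector_derivative_def has_derivative_at_alt by blast
  have close: "norm (hproj (\<sigma> s) - s *\<^sub>R hproj E') \<le> \<eta> * \<bar>s\<bar>" if "\<bar>s\<bar> < d" for s
    using d[of "t\<^sub>0 + s"] that
    by (simp add: hproj_\<sigma> linear_diff bounded_linear.linear bounded_linear_hproj)
  show ?thesis
  proof (intro exI[of _ "min r d"] conjI allI impI)
    show "min r d > 0" using \<open>r > 0\<close> \<open>d > 0\<close> by simp
    fix t assume t: "\<bar>t\<bar> < min r d"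
    have "norm (hproj (\<sigma> t) - t *\<^sub>R hproj E') \<le> \<epsilon> * \<bar>t\<bar>"
      using close[of t] t mult_right_mono[OF \<eta>(3), of "\<bar>t\<bar>"] by simp
    then show "norm (hproj (heis_mult (heis_inv (\<gamma> t\<^sub>0)) (\<gamma> (t\<^sub>0 + t))) - t *\<^sub>R hproj E') \<le> \<epsilon> * \<bar>t\<bar>"
      by (simp add: \<sigma>_def)
    have "\<bar>vert (\<sigma> t)\<bar> \<le> (2 * C\<^sup>2 / real N + 6 * real N * \<eta>) * t\<^sup>2"
    proof (rule vert_lipschitz_curve[where J = "{s. \<bar>s\<bar> < r}" and e = "hproj E'"])
      fix s assume s: "\<bar>s\<bar> \<le> \<bar>t\<bar>"
      show "norm (hproj (\<sigma> s) - s *\<^sub>R hproj E') \<le> \<eta> * \<bar>t\<bar>"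
        using close[of s] s t mult_left_mono[OF s less_imp_le[OF \<eta>(1)]] by linarith
    qed (use lip_\<sigma> t \<eta> \<open>N > 0\<close> e in \<open>auto simp: \<sigma>_def heis_mult_inv\<close>)
    also have "\<dots> \<le> \<epsilon> * t\<^sup>2"
      using N \<eta>(4) by (intro mult_right_mono) auto
    finally show "\<bar>vert (heis_mult (heis_inv (\<gamma> t\<^sub>0)) (\<gamma> (t\<^sub>0 + t)))\<bar> \<le> \<epsilon> * t\<^sup>2"
      by (simp add: \<sigma>_def)
  qed
qed


section \<open>Maximal directional derivatives\<close>

text \<open>The infimum in the definition of \<open>heis_Lip\<close> is attained, since the defining condition on \<open>C\<close> is
  closed.\<close>

lemma heis_Lip_bound:
  assumes "heis_lipschitz f"
  shows heis_Lip_nonneg: "0 \<le> heis_Lip f"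
    and abs_diff_le_heis_Lip: "\<bar>f x - f y\<bar> \<le> heis_Lip f * cc_dist x y"
proof -
  let ?S = "{C. 0 \<le> C \<and> (\<forall>x y. \<bar>f x - f y\<bar> \<le> C * cc_dist x y)}"
  have ne: "?S \<noteq> {}" using assms unfolding heis_lipschitz_def by blast
  show "0 \<le> heis_Lip f"
    unfolding heis_Lip_def by (rule cInf_greatest[OF ne]) blast
  show "\<bar>f x - f y\<bar> \<le> heis_Lip f * cc_dist x y"
  proof (cases "cc_dist x y = 0")
    case True
    obtain C where "\<bar>f x - f y\<bar> \<le> C * cc_dist x y" using ne by blast
    then show ?thesis using True by simp
  next
    case False
    then have "0 < cc_dist x y" using cc_dist_nonneg[of x y] by simp
    have "\<bar>f x - f y\<bar> / cc_dist x y \<le> heis_Lip f"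
      unfolding heis_Lip_def
    proof (rule cInf_greatest[OF ne])
      fix C assume "C \<in> ?S"
      then have "\<bar>f x - f y\<bar> \<le> C * cc_dist x y" by blast
      then show "\<bar>f x - f y\<bar> / cc_dist x y \<le> C"
        using \<open>0 < cc_dist x y\<close> by (simp add: pos_divide_le_eq)
    qed
    then show ?thesis using \<open>0 < cc_dist x y\<close> by (simp add: pos_divide_le_eq)
  qed
qed

text \<open>The value \<open>f y\<close> is compared with the values of \<open>f\<close> at \<open>\<gamma> (t\<^sub>0 + K * r)\<close> and
  \<open>\<gamma> (t\<^sub>0 - K * r)\<close>; the second point is far away from \<open>\<gamma> t\<^sub>0\<close> in the direction opposite to \<open>E'\<close>.\<close>

lemma maximal_directional_derivative_estimate:
  fixes f :: "'n::finite heis \<Rightarrow> real"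
  assumes f: "heis_lipschitz f" and "lipschitz_curve I \<gamma>" "t\<^sub>0 \<in> interior I"
    and "(\<gamma> has_vector_derivative E') (at t\<^sub>0)" and e: "norm (hproj E') = 1"
    and deriv: "((\<lambda>s. f (\<gamma> s)) has_real_derivative heis_Lip f) (at t\<^sub>0)"
    and "\<epsilon> > 0"
  shows "\<exists>\<rho>>0. \<forall>y r. 0 < r \<longrightarrow> r < \<rho> \<longrightarrow>
    norm (hproj (heis_mult (heis_inv (\<gamma> t\<^sub>0)) y)) \<le> r \<longrightarrow>
    \<bar>vert (heis_mult (heis_inv (\<gamma> t\<^sub>0)) y)\<bar> \<le> r\<^sup>2 \<longrightarrow>
    \<bar>f y - f (\<gamma> t\<^sub>0) - heis_Lip f * (hproj (heis_mult (heis_inv (\<gamma> t\<^sub>0)) y) \<bullet> hproj E')\<bar> \<le> \<epsilon> * r"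
proof -
  define L where "L = heis_Lip f"
  define e where "e = hproj E'"
  define x where "x = \<gamma> t\<^sub>0"
  define \<sigma> where "\<sigma> t = heis_mult (heis_inv x) (\<gamma> (t\<^sub>0 + t))" for t
  have "L \<ge> 0" using heis_Lip_nonneg[OF f] by (simp add: L_def)
  \<comment> \<open>The final error is \<open>(1 + 326 * L) * r / K\<close>: one \<open>r / K\<close> from the derivative of \<open>f\<close> along the curve,
    and \<open>L\<close> times the error of \<open>cc_dist_from_far_point\<close>.\<close>
  define K where "K = max 4 ((1 + 326 * L) / \<epsilon>)"
  have "K \<ge> 4" "K > 0" by (auto simp: K_def)
  have "(1 + 326 * L) / \<epsilon> \<le> K" by (simp add: K_def)
  then have K: "(1 + 326 * L) / K \<le> \<epsilon>"
    using \<open>K > 0\<close> \<open>\<epsilon> > 0\<close> by (simp add: field_simps)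
  \<comment> \<open>With relative error \<open>1 / K\<^sup>2\<close>, the absolute errors at time \<open>K * r\<close> are \<open>r / K\<close> and, for the height,
    \<open>r\<^sup>2\<close>.\<close>
  have "1 / K\<^sup>2 > 0" using \<open>K > 0\<close> by simp
  then obtain \<tau> where "\<tau> > 0" and \<tau>: "\<And>t. \<bar>t\<bar> < \<tau> \<Longrightarrow>
      norm (hproj (\<sigma> t) - t *\<^sub>R e) \<le> 1 / K\<^sup>2 * \<bar>t\<bar> \<and> \<bar>vert (\<sigma> t)\<bar> \<le> 1 / K\<^sup>2 * t\<^sup>2"
    using lipschitz_curve_tangent[OF assms(2,3,4,5)] unfolding \<sigma>_def x_def e_def by meson
  obtain d where "d > 0" and d: "\<And>s. norm (s - t\<^sub>0) < d \<Longrightarrow>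
      norm (f (\<gamma> s) - f (\<gamma> t\<^sub>0) - L * (s - t\<^sub>0)) \<le> 1 / K\<^sup>2 * norm (s - t\<^sub>0)"
    using deriv \<open>1 / K\<^sup>2 > 0\<close> unfolding has_field_derivative_def has_derivative_at_alt L_def by blast
  show ?thesis
    unfolding L_def[symmetric] e_def[symmetric] x_def[symmetric]
  proof (intro exI[of _ "min \<tau> d / K"] conjI allI impI)
    show "0 < min \<tau> d / K" using \<open>\<tau> > 0\<close> \<open>d > 0\<close> \<open>K > 0\<close> by simp
    fix y r
    assume "0 < r" "r < min \<tau> d / K"
    then have t: "\<bar>K * r\<bar> < \<tau>" "\<bar>K * r\<bar> < d" "\<bar>- (K * r)\<bar> < \<tau>" "\<bar>- (K * r)\<bar> < d"
      using \<open>K > 0\<close> by (auto simp: field_simps abs_mult)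
    define p where "p = hproj (heis_mult (heis_inv x) y)"
    define c where "c = vert (heis_mult (heis_inv x) y)"
    assume "norm (hproj (heis_mult (heis_inv x) y)) \<le> r"
      and "\<bar>vert (heis_mult (heis_inv x) y)\<bar> \<le> r\<^sup>2"
    then have p: "norm p \<le> r" and c: "\<bar>c\<bar> \<le> r\<^sup>2" by (simp_all add: p_def c_def)
    have y: "heis_mult (heis_inv x) y = point p c" by (simp add: p_def c_def point_hproj_vert)
    have dist: "cc_dist (\<gamma> (t\<^sub>0 + t)) y \<le> K * r - p \<bullet> e' + 326 * r / K"
      if "\<bar>t\<bar> < \<tau>" "\<bar>t\<bar> = K * r" "t *\<^sub>R e = (K * r) *\<^sub>R e'" "norm e' = 1" for t e'
    proof -
      have "cc_dist (\<gamma> (t\<^sub>0 + t)) y = cc_dist (point (hproj (\<sigma> t)) (vert (\<sigma> t))) (point p c)"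
        unfolding point_hproj_vert y[symmetric] \<sigma>_def by (simp add: cc_dist_eq cc_lengths_translate)
      also have "\<dots> \<le> K * r - p \<bullet> e' + 326 * r / K"
      proof (rule cc_dist_from_far_point[OF \<open>norm e' = 1\<close> p c \<open>0 < r\<close> \<open>K \<ge> 4\<close>])
        show "norm (hproj (\<sigma> t) - (K * r) *\<^sub>R e') \<le> r / K"
          using \<tau>[OF that(1)] \<open>K > 0\<close> unfolding that(2,3) by (simp add: power2_eq_square)
        have "t\<^sup>2 = (K * r)\<^sup>2" using that(2) by (metis power2_abs)
        then show "\<bar>vert (\<sigma> t)\<bar> \<le> r\<^sup>2"
          using \<tau>[OF that(1)] \<open>K > 0\<close> by (simp add: power_mult_distrib)
      qed
      finally show ?thesis .
    qed
    have deriv_bound: "\<bar>f (\<gamma> (t\<^sub>0 + t)) - f x - L * t\<bar> \<le> r / K"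
      if "\<bar>t\<bar> < d" "\<bar>t\<bar> = K * r" for t
      using d[of "t\<^sub>0 + t"] that \<open>K > 0\<close> by (simp add: x_def power2_eq_square)
    have lip: "\<bar>f (\<gamma> (t\<^sub>0 + t)) - f y\<bar> \<le> L * D" if "cc_dist (\<gamma> (t\<^sub>0 + t)) y \<le> D" for t D
      using abs_diff_le_heis_Lip[OF f] mult_left_mono[OF that \<open>L \<ge> 0\<close>] unfolding L_def[symmetric]
      by (rule order_trans)
    have "norm e = 1" using assms(5) by (simp add: e_def)
    have Kr: "\<bar>K * r\<bar> = K * r" "\<bar>- (K * r)\<bar> = K * r" using \<open>K > 0\<close> \<open>0 < r\<close> by auto
    have "\<bar>f (\<gamma> (t\<^sub>0 + K * r)) - f y\<bar> \<le> L * (K * r - p \<bullet> e + 326 * r / K)"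
      by (rule lip[OF dist[OF t(1) Kr(1) refl \<open>norm e = 1\<close>]])
    moreover have "\<bar>f (\<gamma> (t\<^sub>0 + - (K * r))) - f y\<bar> \<le> L * (K * r - p \<bullet> (- e) + 326 * r / K)"
      by (rule lip[OF dist[OF t(3) Kr(2)]]) (simp_all add: \<open>norm e = 1\<close>)
    moreover have "\<bar>f (\<gamma> (t\<^sub>0 + K * r)) - f x - L * (K * r)\<bar> \<le> r / K"
      "\<bar>f (\<gamma> (t\<^sub>0 + - (K * r))) - f x - L * (- (K * r))\<bar> \<le> r / K"
      by (rule deriv_bound[OF t(2) Kr(1)], rule deriv_bound[OF t(4) Kr(2)])
    moreover have "L * (K * r - p \<bullet> e + 326 * r / K) = L * (K * r) - L * (p \<bullet> e) + 326 * L * r / K"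
      "L * (K * r - p \<bullet> (- e) + 326 * r / K) = L * (K * r) + L * (p \<bullet> e) + 326 * L * r / K"
      by (simp_all add: algebra_simps)
    ultimately have "\<bar>f y - f x - L * (p \<bullet> e)\<bar> \<le> r / K + 326 * L * r / K"
      by (simp only: abs_le_iff) linarith
    also have "\<dots> = (1 + 326 * L) / K * r"
      by (simp add: add_divide_distrib distrib_right)
    also have "\<dots> \<le> \<epsilon> * r"
      using K \<open>0 < r\<close> by (intro mult_right_mono) auto
    finally show "\<bar>f y - f x - L * (hproj (heis_mult (heis_inv x) y) \<bullet> e)\<bar> \<le> \<epsilon> * r"
      by (simp add: p_def)
  qed
qed

lemma inner_horizontal: "y \<bullet> point e 0 = hproj y \<bullet> e"
  by (cases y; cases e) (simp add: point_def)

lemma heis_linear_inner_hproj: "heis_linear (\<lambda>y. l * (hproj y \<bullet> e))"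
proof -
  have dil: "hproj (heis_dil r y) = r *\<^sub>R hproj y" for r y
    by (cases y) simp
  show ?thesis
    unfolding heis_linear_def
  proof (intro conjI allI impI)
    show "l * (hproj (heis_mult x y) \<bullet> e) = l * (hproj x \<bullet> e) + l * (hproj y \<bullet> e)" for x y
      by (simp add: heis_mult_point inner_add_left distrib_left)
    show "l * (hproj (heis_dil r y) \<bullet> e) = r * (l * (hproj y \<bullet> e))" for r y
      by (simp only: dil inner_scaleR_left mult.left_commute)
  qed
qed

text \<open>A continuous substitute for \<open>cc_dist 0\<close>: it visibly tends to \<open>0\<close> at the origin, and it is bounded by
  a multiple of the distance.\<close>

definition homogeneous_norm :: "'n::finite heis \<Rightarrow> real" where
  "homogeneous_norm y = max (norm (hproj y)) (sqrt \<bar>vert y\<bar>)"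

lemma homogeneous_norm_zero: "homogeneous_norm 0 = 0"
  by (simp add: homogeneous_norm_def linear_0 bounded_linear.linear bounded_linear_hproj bounded_linear_vert)

lemma homogeneous_norm_pos: "y \<noteq> 0 \<Longrightarrow> 0 < homogeneous_norm y"
proof (rule ccontr)
  assume "y \<noteq> 0" "\<not> 0 < homogeneous_norm y"
  then have "hproj y = 0" "vert y = 0"
    by (auto simp: homogeneous_norm_def not_less le_max_iff_disj)
  then have "y = 0"
    using point_hproj_vert[of y] by (simp add: point_def zero_prod_def)
  with \<open>y \<noteq> 0\<close> show False ..
qed

lemma norm_hproj_le_homogeneous_norm: "norm (hproj y) \<le> homogeneous_norm y"
  by (simp add: homogeneous_norm_def)

lemma abs_vert_le_homogeneous_norm: "\<bar>vert y\<bar> \<le> (homogeneous_norm y)\<^sup>2"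
  by (rule sqrt_le_D) (simp add: homogeneous_norm_def)

lemma homogeneous_norm_le_cc_dist: "homogeneous_norm y \<le> 2 * cc_dist 0 y"
proof -
  have "\<bar>vert y\<bar> \<le> (2 * cc_dist 0 y)\<^sup>2"
    using abs_vert_le_cc_dist[of y] by (simp add: power_mult_distrib)
  then show ?thesis
    using norm_hproj_le_cc_dist[of y] cc_dist_nonneg[of 0 y]
    by (auto simp: homogeneous_norm_def intro: real_le_lsqrt)
qed

lemma tendsto_homogeneous_norm: "((\<lambda>y. homogeneous_norm (heis_mult (heis_inv x) y)) \<longlongrightarrow> 0) (at x)"
proof -
  have 1: "((\<lambda>y. heis_mult (heis_inv x) y) \<longlongrightarrow> heis_mult (heis_inv x) x) (at x)"
    unfolding heis_mult_shear
    by (intro tendsto_intros bounded_linear.tendsto[OF bounded_linear_shear])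
  have "((\<lambda>y. homogeneous_norm (heis_mult (heis_inv x) y)) \<longlongrightarrow> homogeneous_norm (heis_mult (heis_inv x) x)) (at x)"
    unfolding homogeneous_norm_def
    by (intro tendsto_intros bounded_linear.tendsto[OF bounded_linear_hproj 1]
        bounded_linear.tendsto[OF bounded_linear_vert 1])
  then show ?thesis by (simp add: heis_mult_inv homogeneous_norm_zero)
qed

theorem theorem3p6:
  fixes f :: "'n::finite heis \<Rightarrow> real" and x :: "'n heis" and E :: "'n heis \<Rightarrow> 'n heis"
  assumes "heis_lipschitz f"
    and "E \<in> HV"
    and "omega E = 1"
    and "has_field_deriv f E x (heis_Lip f)"
  shows "has_pansu_derivative f (\<lambda>y. heis_Lip f * (y \<bullet> E 0)) x \<and>
    (\<forall>y. heis_Lip f * (y \<bullet> E 0) = heis_Lip f * (hproj y \<bullet> hproj_field E))"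
proof -
  obtain e where E: "E = hfield e" using \<open>E \<in> HV\<close> unfolding HV_def by blast
  have "norm e = 1" using \<open>omega E = 1\<close> by (simp add: E omega_hfield)
  have E0: "E 0 = point e 0"
    by (simp add: E hfield_point linear_0 bounded_linear.linear bounded_linear_hproj bounded_linear_rot)
  have proj_E: "hproj_field E = e" by (simp add: hproj_field_def E0)
  obtain I \<gamma> t where "lipschitz_curve I \<gamma>" "t \<in> interior I" and \<gamma>t: "\<gamma> t = x"
    and "(\<gamma> has_vector_derivative E x) (at t)"
    and "((\<lambda>s. f (\<gamma> s)) has_real_derivative heis_Lip f) (at t)"
    using assms(4) unfolding has_field_deriv_def by blast
  moreover have hproj_E: "hproj (E x) = e" by (simp add: E hproj_hfield)
  ultimately have est: "\<exists>\<rho>>0. \<forall>y r. 0 < r \<longrightarrow> r < \<rho> \<longrightarrow>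
      norm (hproj (heis_mult (heis_inv x) y)) \<le> r \<longrightarrow> \<bar>vert (heis_mult (heis_inv x) y)\<bar> \<le> r\<^sup>2 \<longrightarrow>
      \<bar>f y - f x - heis_Lip f * (hproj (heis_mult (heis_inv x) y) \<bullet> e)\<bar> \<le> \<epsilon> * r" if "\<epsilon> > 0" for \<epsilon>
    using maximal_directional_derivative_estimate[OF assms(1), of I \<gamma> t "E x" \<epsilon>] that \<open>norm e = 1\<close>
    by simp
  have "((\<lambda>y. \<bar>f y - f x - heis_Lip f * (heis_mult (heis_inv x) y \<bullet> E 0)\<bar> / cc_dist x y) \<longlongrightarrow> 0) (at x)"
  proof (rule tendstoI)
    fix \<epsilon> :: real assume "\<epsilon> > 0"
    then obtain \<rho> where "\<rho> > 0" and \<rho>: "\<And>y r. 0 < r \<Longrightarrow> r < \<rho> \<Longrightarrow>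
      norm (hproj (heis_mult (heis_inv x) y)) \<le> r \<Longrightarrow> \<bar>vert (heis_mult (heis_inv x) y)\<bar> \<le> r\<^sup>2 \<Longrightarrow>
      \<bar>f y - f x - heis_Lip f * (hproj (heis_mult (heis_inv x) y) \<bullet> e)\<bar> \<le> \<epsilon> / 4 * r"
      using est[of "\<epsilon> / 4"] by auto
    have "\<forall>\<^sub>F y in at x. homogeneous_norm (heis_mult (heis_inv x) y) < \<rho>"
      using tendsto_homogeneous_norm \<open>\<rho> > 0\<close> by (rule order_tendstoD(2))
    moreover have "\<forall>\<^sub>F y in at x. y \<noteq> x"
      by (simp add: eventually_at_filter)
    ultimately show "\<forall>\<^sub>F y in at x.
        dist (\<bar>f y - f x - heis_Lip f * (heis_mult (heis_inv x) y \<bullet> E 0)\<bar> / cc_dist x y) 0 < \<epsilon>"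
    proof eventually_elim
      case (elim y)
      define w where "w = heis_mult (heis_inv x) y"
      have "heis_mult x w = y"
        by (simp add: w_def heis_mult_inv heis_mult_zero flip: heis_mult_assoc)
      then have "w \<noteq> 0" using elim(2) by (auto simp: heis_mult_zero)
      then have "0 < homogeneous_norm w" by (rule homogeneous_norm_pos)
      have le: "homogeneous_norm w \<le> 2 * cc_dist x y"
        using homogeneous_norm_le_cc_dist[of w] by (simp add: w_def cc_dist_origin[of x y])
      then have "0 < cc_dist x y" using \<open>0 < homogeneous_norm w\<close> by simp
      have "\<bar>f y - f x - heis_Lip f * (hproj w \<bullet> e)\<bar> \<le> \<epsilon> / 4 * homogeneous_norm w"
        unfolding w_def
        by (rule \<rho>) (use \<open>0 < homogeneous_norm w\<close> elim(1) in
            \<open>simp_all add: w_def norm_hproj_le_homogeneous_norm abs_vert_le_homogeneous_norm\<close>)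
      also have "\<dots> \<le> \<epsilon> / 4 * (2 * cc_dist x y)"
        using le \<open>\<epsilon> > 0\<close> by (intro mult_left_mono) auto
      also have "\<dots> < \<epsilon> * cc_dist x y"
        using \<open>\<epsilon> > 0\<close> \<open>0 < cc_dist x y\<close> by simp
      finally show ?case
        using \<open>0 < cc_dist x y\<close>
        by (simp add: w_def E0 inner_horizontal pos_divide_less_eq)
    qed
  qed
  moreover have "heis_linear (\<lambda>y. heis_Lip f * (y \<bullet> E 0))"
    unfolding E0 inner_horizontal by (rule heis_linear_inner_hproj)
  ultimately show ?thesis
    unfolding has_pansu_derivative_def by (simp add: E0 inner_horizontal proj_E)
qed

end
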